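(* Let $(M^n,\phi,\xi,\eta,g)$ be an $n$-dimensional para-Sasakian manifold, equipped with the quarter-symmetric metric connection $\tilde\nabla_X Y=\nabla_X Y+\eta(Y)\phi X-g(\phi X,Y)\xi$, where $\nabla$ is the Levi-Civita connection of $g$. Let $\tilde R$ and $\tilde S$ be the curvature tensor and Ricci tensor of $\tilde\nabla$, and let $$\tilde P(X,Y)Z=\tilde R(X,Y)Z-\frac{1}{n-1}[\tilde S(Y,Z)X-\tilde S(X,Z)Y]$$ be its projective curvature tensor. Suppose that $M^n$ is projectively pseudosymmetric with respect to $\tilde\nabla$, i.e. there is a function $L_{\tilde P}$ on $U_{\tilde P}=\{x\in M^n:\tilde P\neq0\text{ at }x\}$ such that $$\tilde R(X,Y)\cdot\tilde P=L_{\tilde P}\,[(X\wedge_gY)\cdot\tilde P]$$ holds on $U_{\tilde P}$ for all vector fields $X,Y$. Then $M^n$ is projectively flat with respect to $\tilde\nabla$ (i.e. $\tilde P=0$), or $L_{\tilde P}=-2$.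
   Context: Para-Sasakian manifold: a differentiable manifold $M^n$ with a $(1,1)$-tensor field $\phi$, a vector field $\xi$, a 1-form $\eta$ and a Riemannian metric $g$ such that, for all vector fields $X,Y$: $\phi^2X=X-\eta(X)\xi$, $\eta(\xi)=1$, $\phi\xi=0$, $\eta(\phi X)=0$, $g(X,\xi)=\eta(X)$, $g(\phi X,\phi Y)=g(X,Y)-\eta(X)\eta(Y)$, and moreover $(\nabla_X\phi)Y=-g(X,Y)\xi-\eta(Y)X+2\eta(X)\eta(Y)\xi$, $d\eta=0$, $\nabla_X\xi=\phi X$, with $\nabla$ the Levi-Civita connection of $g$. (Here $n>1$, so that $\tilde P$ is defined.) Curvature: $\tilde R(X,Y)Z=\tilde\nabla_X\tilde\nabla_YZ-\tilde\nabla_Y\tilde\nabla_XZ-\tilde\nabla_{[X,Y]}Z$. Ricci tensor: $\tilde S(Y,Z)=\mathrm{trace}\{X\mapsto\tilde R(X,Y)Z\}$. $(X\wedge_gY)$ is the endomorphism $(X\wedge_gY)Z=g(Y,Z)X-g(X,Z)Y$. For an endomorphism $A$ (here $A=\tilde R(X,Y)$ or $A=X\wedge_gY$) acting as a derivation on a $(1,3)$-tensor $T$: $(A\cdot T)(U,V)W=A(T(U,V)W)-T(AU,V)W-T(U,AV)W-T(U,V)AW$. *)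

theory Defs
  imports "HOL-Analysis.Analysis" "HOL-Library.Function_Algebras"
begin

section \<open>Smooth manifolds\<close>

text \<open>Only used for open sets, so derivatives are taken with respect to the whole space.\<close>

primrec Ck_on :: "nat \<Rightarrow> 'e::real_normed_vector set \<Rightarrow> ('e \<Rightarrow> 'f::real_normed_vector) \<Rightarrow> bool" where
  "Ck_on 0 S f \<longleftrightarrow> continuous_on S f"
| "Ck_on (Suc k) S f \<longleftrightarrow>
     (\<forall>x\<in>S. f differentiable (at x)) \<and> (\<forall>v. Ck_on k S (\<lambda>x. frechet_derivative f (at x) v))"

definition smooth_on :: "'e::real_normed_vector set \<Rightarrow> ('e \<Rightarrow> 'f::real_normed_vector) \<Rightarrow> bool" where
  "smooth_on S f \<longleftrightarrow> (\<forall>k. Ck_on k S f)"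

text \<open>The manifold is the whole type \<open>'a\<close>; a chart is a pair of its (open) domain and its
  coordinate map into \<open>\<real>\<^sup>n\<close>, where \<open>n = CARD('n)\<close>.\<close>

type_synonym ('a, 'n) chart = "'a set \<times> ('a \<Rightarrow> real ^ 'n)"

definition chart_inv :: "('a, 'n::finite) chart \<Rightarrow> real ^ 'n \<Rightarrow> 'a" where
  "chart_inv c = inv_into (fst c) (snd c)"

definition smooth_atlas ::
    "('a::{t2_space,second_countable_topology}, 'n::finite) chart set \<Rightarrow> bool" where
  "smooth_atlas A \<longleftrightarrow>
     (\<Union>c\<in>A. fst c) = UNIV \<and>
     (\<forall>c\<in>A. open (fst c) \<and> open (snd c ` fst c) \<and>
        homeomorphism (fst c) (snd c ` fst c) (snd c) (chart_inv c)) \<and>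
     (\<forall>c\<in>A. \<forall>d\<in>A. smooth_on (snd c ` (fst c \<inter> fst d)) (snd d \<circ> chart_inv c))"

definition smooth_functions :: "('a, 'n::finite) chart set \<Rightarrow> ('a \<Rightarrow> real) set" where
  "smooth_functions A = {f. \<forall>c\<in>A. smooth_on (snd c ` fst c) (f \<circ> chart_inv c)}"

section \<open>Tangent vectors and vector fields\<close>

text \<open>A tangent vector at \<open>p\<close> is a directional derivative \<open>f \<mapsto> \<Sum>\<^sub>i w\<^sup>i (\<partial>f/\<partial>x\<^sup>i)(p)\<close> on the smooth
  functions. It is made 0 on all other functions, so that two tangent vectors are equal as soon as
  they agree on smooth functions. The vector operations are the pointwise ones.\<close>

type_synonym 'a tvec = "('a \<Rightarrow> real) \<Rightarrow> real"
type_synonym 'a vfield = "'a \<Rightarrow> 'a tvec"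

definition coord_vec ::
    "('a, 'n::finite) chart set \<Rightarrow> ('a, 'n) chart \<Rightarrow> 'a \<Rightarrow> real ^ 'n \<Rightarrow> 'a tvec" where
  "coord_vec A c p w =
     (\<lambda>f. if f \<in> smooth_functions A
          then frechet_derivative (f \<circ> chart_inv c) (at (snd c p)) w else 0)"

definition tangent_space :: "('a, 'n::finite) chart set \<Rightarrow> 'a \<Rightarrow> 'a tvec set" where
  "tangent_space A p = {coord_vec A c p w | c w. c \<in> A \<and> p \<in> fst c}"

definition scale_tvec :: "real \<Rightarrow> 'a tvec \<Rightarrow> 'a tvec" (infixr "*\<^sub>T" 75) where
  "a *\<^sub>T v = (\<lambda>f. a * v f)"

definition scale_vfield :: "('a \<Rightarrow> real) \<Rightarrow> 'a vfield \<Rightarrow> 'a vfield" (infixr "*\<^sub>V" 75) where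
  "h *\<^sub>V X = (\<lambda>p. h p *\<^sub>T X p)"

definition vector_fields :: "('a, 'n::finite) chart set \<Rightarrow> 'a vfield set" where
  "vector_fields A =
     {X. (\<forall>p. X p \<in> tangent_space A p) \<and>
         (\<forall>f\<in>smooth_functions A. (\<lambda>p. X p f) \<in> smooth_functions A)}"

definition act :: "'a vfield \<Rightarrow> ('a \<Rightarrow> real) \<Rightarrow> 'a \<Rightarrow> real" where
  "act X f = (\<lambda>p. X p f)"

definition lie_bracket :: "'a vfield \<Rightarrow> 'a vfield \<Rightarrow> 'a vfield" where
  "lie_bracket X Y = (\<lambda>p f. X p (act Y f) - Y p (act X f))"

section \<open>Tensor fields\<close>

text \<open>Tensor fields are families of multilinear maps on the tangent spaces, whose values outside
  the tangent spaces are irrelevant.\<close>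

definition ev1 :: "('a \<Rightarrow> 'a tvec \<Rightarrow> 'b) \<Rightarrow> 'a vfield \<Rightarrow> 'a \<Rightarrow> 'b" where
  "ev1 T X = (\<lambda>p. T p (X p))"

definition ev2 :: "('a \<Rightarrow> 'a tvec \<Rightarrow> 'a tvec \<Rightarrow> 'b) \<Rightarrow> 'a vfield \<Rightarrow> 'a vfield \<Rightarrow> 'a \<Rightarrow> 'b" where
  "ev2 T X Y = (\<lambda>p. T p (X p) (Y p))"

definition one_form :: "('a, 'n::finite) chart set \<Rightarrow> ('a \<Rightarrow> 'a tvec \<Rightarrow> real) \<Rightarrow> bool" where
  "one_form A \<eta> \<longleftrightarrow>
     (\<forall>p. \<forall>u\<in>tangent_space A p. \<forall>v\<in>tangent_space A p. \<forall>a.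
        \<eta> p (u + v) = \<eta> p u + \<eta> p v \<and> \<eta> p (a *\<^sub>T u) = a * \<eta> p u) \<and>
     (\<forall>X\<in>vector_fields A. ev1 \<eta> X \<in> smooth_functions A)"

definition endomorphism_field ::
    "('a, 'n::finite) chart set \<Rightarrow> ('a \<Rightarrow> 'a tvec \<Rightarrow> 'a tvec) \<Rightarrow> bool" where
  "endomorphism_field A \<phi> \<longleftrightarrow>
     (\<forall>p. \<forall>u\<in>tangent_space A p. \<forall>v\<in>tangent_space A p. \<forall>a.
        \<phi> p u \<in> tangent_space A p \<and>
        \<phi> p (u + v) = \<phi> p u + \<phi> p v \<and> \<phi> p (a *\<^sub>T u) = a *\<^sub>T \<phi> p u) \<and>
     (\<forall>X\<in>vector_fields A. ev1 \<phi> X \<in> vector_fields A)"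

definition riemannian_metric ::
    "('a, 'n::finite) chart set \<Rightarrow> ('a \<Rightarrow> 'a tvec \<Rightarrow> 'a tvec \<Rightarrow> real) \<Rightarrow> bool" where
  "riemannian_metric A g \<longleftrightarrow>
     (\<forall>p. \<forall>u\<in>tangent_space A p. \<forall>v\<in>tangent_space A p. \<forall>w\<in>tangent_space A p. \<forall>a.
        g p (u + v) w = g p u w + g p v w \<and> g p (a *\<^sub>T u) v = a * g p u v \<and>
        g p u v = g p v u \<and> (u \<noteq> 0 \<longrightarrow> g p u u > 0)) \<and>
     (\<forall>X\<in>vector_fields A. \<forall>Y\<in>vector_fields A. ev2 g X Y \<in> smooth_functions A)"

text \<open>Exterior derivative of a 1-form (up to the factor 1/2 used by some authors).\<close>

definition ext_deriv :: "('a \<Rightarrow> 'a tvec \<Rightarrow> real) \<Rightarrow> 'a vfield \<Rightarrow> 'a vfield \<Rightarrow> 'a \<Rightarrow> real" where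
  "ext_deriv \<eta> X Y = act X (ev1 \<eta> Y) - act Y (ev1 \<eta> X) - ev1 \<eta> (lie_bracket X Y)"

text \<open>The trace of an endomorphism of the tangent space at \<open>p\<close>, computed in the coordinate basis of
  some chart around \<open>p\<close>; the choice of the chart does not matter.\<close>

definition coords ::
    "('a, 'n::finite) chart set \<Rightarrow> ('a, 'n) chart \<Rightarrow> 'a \<Rightarrow> 'a tvec \<Rightarrow> real ^ 'n" where
  "coords A c p v = (THE w. coord_vec A c p w = v)"

definition tangent_trace ::
    "('a, 'n::finite) chart set \<Rightarrow> 'a \<Rightarrow> ('a tvec \<Rightarrow> 'a tvec) \<Rightarrow> real" where
  "tangent_trace A p E =
     (let c = (SOME c. c \<in> A \<and> p \<in> fst c)
      in \<Sum>i\<in>UNIV. coords A c p (E (coord_vec A c p (axis i 1))) $ i)"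

section \<open>Connections and curvature\<close>

type_synonym 'a connection = "'a vfield \<Rightarrow> 'a vfield \<Rightarrow> 'a vfield"

definition affine_connection :: "('a, 'n::finite) chart set \<Rightarrow> 'a connection \<Rightarrow> bool" where
  "affine_connection A D \<longleftrightarrow>
     (\<forall>X\<in>vector_fields A. \<forall>Y\<in>vector_fields A. \<forall>Z\<in>vector_fields A. \<forall>f\<in>smooth_functions A.
        D X Y \<in> vector_fields A \<and>
        D (X + Y) Z = D X Z + D Y Z \<and>
        D (f *\<^sub>V X) Y = f *\<^sub>V D X Y \<and>
        D X (Y + Z) = D X Y + D X Z \<and>
        D X (f *\<^sub>V Y) = f *\<^sub>V D X Y + act X f *\<^sub>V Y)"

definition levi_civita ::
    "('a, 'n::finite) chart set \<Rightarrow> ('a \<Rightarrow> 'a tvec \<Rightarrow> 'a tvec \<Rightarrow> real) \<Rightarrow> 'a connection \<Rightarrow> bool" where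
  "levi_civita A g D \<longleftrightarrow>
     affine_connection A D \<and>
     (\<forall>X\<in>vector_fields A. \<forall>Y\<in>vector_fields A. D X Y - D Y X = lie_bracket X Y) \<and>
     (\<forall>X\<in>vector_fields A. \<forall>Y\<in>vector_fields A. \<forall>Z\<in>vector_fields A.
        act X (ev2 g Y Z) = ev2 g (D X Y) Z + ev2 g Y (D X Z))"

definition curvature :: "'a connection \<Rightarrow> 'a vfield \<Rightarrow> 'a vfield \<Rightarrow> 'a vfield \<Rightarrow> 'a vfield" where
  "curvature D X Y Z = D X (D Y Z) - D Y (D X Z) - D (lie_bracket X Y) Z"

text \<open>The value of the curvature tensor on tangent vectors at \<open>p\<close>: extend them to vector fields.
  As the curvature is a tensor, the choice of the extensions does not matter.\<close>

definition extend_tvec :: "('a, 'n::finite) chart set \<Rightarrow> 'a \<Rightarrow> 'a tvec \<Rightarrow> 'a vfield" where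
  "extend_tvec A p v = (SOME X. X \<in> vector_fields A \<and> X p = v)"

definition curvature_at ::
    "('a, 'n::finite) chart set \<Rightarrow> 'a connection \<Rightarrow> 'a \<Rightarrow> 'a tvec \<Rightarrow> 'a tvec \<Rightarrow> 'a tvec \<Rightarrow> 'a tvec" where
  "curvature_at A D p u v w =
     curvature D (extend_tvec A p u) (extend_tvec A p v) (extend_tvec A p w) p"

definition ricci_at ::
    "('a, 'n::finite) chart set \<Rightarrow> 'a connection \<Rightarrow> 'a \<Rightarrow> 'a tvec \<Rightarrow> 'a tvec \<Rightarrow> real" where
  "ricci_at A D p v w = tangent_trace A p (\<lambda>u. curvature_at A D p u v w)"

definition projective_curvature_at ::
    "('a, 'n::finite) chart set \<Rightarrow> 'a connection \<Rightarrow> 'a \<Rightarrow> 'a tvec \<Rightarrow> 'a tvec \<Rightarrow> 'a tvec \<Rightarrow> 'a tvec" where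
  "projective_curvature_at A D p u v w =
     curvature_at A D p u v w
     - (1 / (real CARD('n) - 1)) *\<^sub>T (ricci_at A D p v w *\<^sub>T u - ricci_at A D p u w *\<^sub>T v)"

definition projectively_flat_at :: "('a, 'n::finite) chart set \<Rightarrow> 'a connection \<Rightarrow> 'a \<Rightarrow> bool" where
  "projectively_flat_at A D p \<longleftrightarrow>
     (\<forall>u\<in>tangent_space A p. \<forall>v\<in>tangent_space A p. \<forall>w\<in>tangent_space A p.
        projective_curvature_at A D p u v w = 0)"

section \<open>Para-Sasakian manifolds and pseudosymmetry\<close>

definition para_sasakian ::
    "('a::{t2_space,second_countable_topology}, 'n::finite) chart set \<Rightarrow>
     ('a \<Rightarrow> 'a tvec \<Rightarrow> 'a tvec) \<Rightarrow> 'a vfield \<Rightarrow> ('a \<Rightarrow> 'a tvec \<Rightarrow> real) \<Rightarrow>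
     ('a \<Rightarrow> 'a tvec \<Rightarrow> 'a tvec \<Rightarrow> real) \<Rightarrow> 'a connection \<Rightarrow> bool" where
  "para_sasakian A \<phi> \<xi> \<eta> g D \<longleftrightarrow>
     smooth_atlas A \<and> endomorphism_field A \<phi> \<and> \<xi> \<in> vector_fields A \<and> one_form A \<eta> \<and>
     riemannian_metric A g \<and> levi_civita A g D \<and>
     ev1 \<eta> \<xi> = 1 \<and> ev1 \<phi> \<xi> = 0 \<and>
     (\<forall>X\<in>vector_fields A. \<forall>Y\<in>vector_fields A.
        ev1 \<phi> (ev1 \<phi> X) = X - ev1 \<eta> X *\<^sub>V \<xi> \<and>
        ev1 \<eta> (ev1 \<phi> X) = 0 \<and>
        ev2 g X \<xi> = ev1 \<eta> X \<and>
        ev2 g (ev1 \<phi> X) (ev1 \<phi> Y) = ev2 g X Y - ev1 \<eta> X * ev1 \<eta> Y \<and>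
        D X (ev1 \<phi> Y) - ev1 \<phi> (D X Y) =
          - (ev2 g X Y *\<^sub>V \<xi>) - ev1 \<eta> Y *\<^sub>V X + (2 * ev1 \<eta> X * ev1 \<eta> Y) *\<^sub>V \<xi> \<and>
        ext_deriv \<eta> X Y = 0 \<and>
        D X \<xi> = ev1 \<phi> X)"

definition quarter_symmetric_connection ::
    "('a \<Rightarrow> 'a tvec \<Rightarrow> 'a tvec) \<Rightarrow> 'a vfield \<Rightarrow> ('a \<Rightarrow> 'a tvec \<Rightarrow> real) \<Rightarrow>
     ('a \<Rightarrow> 'a tvec \<Rightarrow> 'a tvec \<Rightarrow> real) \<Rightarrow> 'a connection \<Rightarrow> 'a connection" where
  "quarter_symmetric_connection \<phi> \<xi> \<eta> g D X Y =
     D X Y + ev1 \<eta> Y *\<^sub>V ev1 \<phi> X - ev2 g (ev1 \<phi> X) Y *\<^sub>V \<xi>"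

definition wedge :: "('a tvec \<Rightarrow> 'a tvec \<Rightarrow> real) \<Rightarrow> 'a tvec \<Rightarrow> 'a tvec \<Rightarrow> 'a tvec \<Rightarrow> 'a tvec" where
  "wedge h x y z = h y z *\<^sub>T x - h x z *\<^sub>T y"

definition derivation_action ::
    "('a tvec \<Rightarrow> 'a tvec) \<Rightarrow> ('a tvec \<Rightarrow> 'a tvec \<Rightarrow> 'a tvec \<Rightarrow> 'a tvec) \<Rightarrow>
     'a tvec \<Rightarrow> 'a tvec \<Rightarrow> 'a tvec \<Rightarrow> 'a tvec" where
  "derivation_action E T u v w = E (T u v w) - T (E u) v w - T u (E v) w - T u v (E w)"

definition projectively_pseudosymmetric ::
    "('a, 'n::finite) chart set \<Rightarrow> ('a \<Rightarrow> 'a tvec \<Rightarrow> 'a tvec \<Rightarrow> real) \<Rightarrow> 'a connection \<Rightarrow>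
     ('a \<Rightarrow> real) \<Rightarrow> bool" where
  "projectively_pseudosymmetric A g D L \<longleftrightarrow>
     (\<forall>p. \<not> projectively_flat_at A D p \<longrightarrow>
        (\<forall>X\<in>vector_fields A. \<forall>Y\<in>vector_fields A.
         \<forall>u\<in>tangent_space A p. \<forall>v\<in>tangent_space A p. \<forall>w\<in>tangent_space A p.
           derivation_action (curvature_at A D p (X p) (Y p)) (projective_curvature_at A D p) u v w
           = L p *\<^sub>T derivation_action (wedge (g p) (X p) (Y p)) (projective_curvature_at A D p) u v w))"

end

(*
  Idea. The identity R~(U,V) xi = 2 (eta(U) V - eta(V) U) gives S~(V,xi) = -2 (n-1) eta(V) and hence
  P~(U,V) xi = 0. At a point, R~(xi,W) = -2 (xi ^ W), so for X = xi, Y = W the hypothesis reads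
  (L + 2) (xi ^ W) . P~ = 0. Evaluated on (U, V, xi), where (xi ^ W) xi = eta(W) xi - W, it
  becomes (L + 2) P~(U,V) W = 0.
*)
theory Submission
  imports Defs "HOL-Real_Asymp.Real_Asymp"
begin

section \<open>Calculus of smooth functions\<close>

text \<open>\<open>curvature_at\<close> evaluates on fields picked by \<open>SOME\<close>, so each
  pointwise identity first needs independence of that choice. It comes from the metric: for any
  metric connection g(R(X,Y)Z,W) = -g(Z,R(X,Y)W), where Z enters only through its value. The first
  slot is then reached by pair symmetry of the Levi-Civita curvature. Bump functions serve to extend
  tangent vectors to fields and to separate coordinate vectors, which gives the trace its meaning.

  The constant -2 is a sum of two equal contributions: R(xi,W) = -(xi ^ W) for the Levi-Civita
  connection, and the correction terms of the quarter-symmetric connection give a second -(xi ^ W),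
  their phi terms vanishing because phi xi = 0.

  The argument xi is chosen because an endomorphism E acting on P~ at (U,V,xi) leaves just
  -P~(U,V)(E xi): the other three terms contain P~(.,.) xi = 0. So linearity of P~ is wanted only in
  its third slot, the one that skewness controls.\<close>

lemma frechet_derivative_eqI: "(f has_derivative f') (at x) \<Longrightarrow> frechet_derivative f (at x) = f'"
  by (metis frechet_derivative_at)

text \<open>\<open>frechet_derivative\<close> is a choice from the predicate
  \<open>has_derivative\<close>. Functions that agree near x satisfy the same predicate, so the
  choices coincide even where no derivative exists.\<close>

lemma frechet_derivative_cong_open:
  assumes "open S" "x \<in> S" "\<And>y. y \<in> S \<Longrightarrow> f y = g y"
  shows "frechet_derivative f (at x) = frechet_derivative g (at x)"
proof -
  have "(f has_derivative f') (at x) \<longleftrightarrow> (g has_derivative f') (at x)" for f'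
    using assms by (metis has_derivative_transform_within_open)
  then show ?thesis unfolding frechet_derivative_def by simp
qed

lemma differentiable_cong_open:
  assumes "open S" "x \<in> S" "\<And>y. y \<in> S \<Longrightarrow> f y = g y"
  shows "f differentiable (at x) \<longleftrightarrow> g differentiable (at x)"
  using assms unfolding differentiable_def by (metis has_derivative_transform_within_open)

lemma Ck_on_subset: "Ck_on k S f \<Longrightarrow> T \<subseteq> S \<Longrightarrow> Ck_on k T f"
  by (induction k arbitrary: f) (auto intro: continuous_on_subset)

lemma Ck_on_cong_open:
  assumes "open S" "\<And>x. x \<in> S \<Longrightarrow> f x = g x"
  shows "Ck_on k S f \<longleftrightarrow> Ck_on k S g"
  using assms(2)
proof (induction k arbitrary: f g)
  case 0
  then show ?case by (auto cong: continuous_on_cong)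
next
  case (Suc k)
  have "Ck_on k S (\<lambda>x. frechet_derivative f (at x) v) \<longleftrightarrow>
        Ck_on k S (\<lambda>x. frechet_derivative g (at x) v)" for v
    by (rule Suc.IH) (use assms(1) Suc.prems frechet_derivative_cong_open in metis)
  then show ?case
    using differentiable_cong_open[OF assms(1) _ Suc.prems] by auto
qed

lemma Ck_on_SucD: "Ck_on (Suc k) S f \<Longrightarrow> Ck_on k S f"
proof (induction k arbitrary: f)
  case 0
  then show ?case
    by (auto intro!: continuous_at_imp_continuous_on differentiable_imp_continuous_within)
next
  case (Suc k)
  then show ?case by (metis Ck_on.simps(2))
qed

text \<open>Allows a function glued from pieces to be checked on an open cover.\<close>

lemma Ck_on_local:
  assumes "\<And>x. x \<in> S \<Longrightarrow> \<exists>U. open U \<and> x \<in> U \<and> Ck_on k U f"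
  shows "Ck_on k S f"
  using assms
proof (induction k arbitrary: f)
  case 0
  then show ?case
    by (auto intro!: continuous_at_imp_continuous_on simp: continuous_on_eq_continuous_at)
       (metis continuous_on_eq_continuous_at)
next
  case (Suc k)
  then show ?case by (auto) metis+
qed

lemma Ck_on_const: "Ck_on k S (\<lambda>x. c)"
  by (induction k arbitrary: c) auto

lemma Ck_on_bounded_linear:
  assumes T: "bounded_linear T"
  shows "Ck_on k S T"
proof (cases k)
  case 0
  then show ?thesis using T by (auto intro: linear_continuous_on)
next
  case (Suc l)
  have "frechet_derivative T (at x) = T" for x
    by (rule frechet_derivative_eqI) (rule bounded_linear_imp_has_derivative[OF T])
  then show ?thesis
    using Suc bounded_linear_imp_differentiable[OF T] by (simp add: Ck_on_const)
qed

lemma Ck_on_bounded_linear_compose: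
  assumes T: "bounded_linear T" and "open S" "Ck_on k S f"
  shows "Ck_on k S (\<lambda>x. T (f x))"
  using assms(3)
proof (induction k arbitrary: f)
  case 0
  then show ?case using T by (auto intro: bounded_linear.continuous_on)
next
  case (Suc k)
  have d: "((\<lambda>x. T (f x)) has_derivative (\<lambda>v. T (frechet_derivative f (at x) v))) (at x)"
    if "x \<in> S" for x
    by (rule bounded_linear.has_derivative[OF T])
       (use Suc.prems that in \<open>simp add: frechet_derivative_works[symmetric]\<close>)
  have "Ck_on k S (\<lambda>x. frechet_derivative (\<lambda>x. T (f x)) (at x) v)" for v
  proof -
    have "Ck_on k S (\<lambda>x. T (frechet_derivative f (at x) v))"
      using Suc by auto
    then show ?thesis
      by (subst Ck_on_cong_open[OF \<open>open S\<close>, of _ "\<lambda>x. T (frechet_derivative f (at x) v)"])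
         (auto simp: frechet_derivative_eqI[OF d])
  qed
  then show ?case using d differentiableI by auto blast
qed

lemma Ck_on_add:
  assumes "open S" "Ck_on k S f" "Ck_on k S g"
  shows "Ck_on k S (\<lambda>x. f x + g x)"
  using assms(2,3)
proof (induction k arbitrary: f g)
  case 0
  then show ?case by (auto intro: continuous_on_add)
next
  case (Suc k)
  have d: "((\<lambda>x. f x + g x) has_derivative
      (\<lambda>v. frechet_derivative f (at x) v + frechet_derivative g (at x) v)) (at x)"
    if "x \<in> S" for x
    using Suc.prems that frechet_derivative_works by (auto intro!: has_derivative_add)
  have "Ck_on k S (\<lambda>x. frechet_derivative (\<lambda>x. f x + g x) (at x) v)" for v
    using Suc by (subst Ck_on_cong_open[OF \<open>open S\<close>,
         of _ "\<lambda>x. frechet_derivative f (at x) v + frechet_derivative g (at x) v"])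
         (auto simp: frechet_derivative_eqI[OF d])
  then show ?case using d differentiableI by auto blast
qed

lemma Ck_on_mult:
  fixes f g :: "'e::real_normed_vector \<Rightarrow> real"
  assumes "open S" "Ck_on k S f" "Ck_on k S g"
  shows "Ck_on k S (\<lambda>x. f x * g x)"
  using assms(2,3)
proof (induction k arbitrary: f g)
  case 0
  then show ?case by (auto intro: continuous_on_mult)
next
  case (Suc k)
  have d: "((\<lambda>x. f x * g x) has_derivative
      (\<lambda>v. f x * frechet_derivative g (at x) v + frechet_derivative f (at x) v * g x)) (at x)"
    if "x \<in> S" for x
    using Suc.prems that frechet_derivative_works by (auto intro!: has_derivative_mult)
  \<comment> \<open>The product rule keeps one factor undifferentiated, so the induction needs f and
    g themselves at level k.\<close>
  have fg: "Ck_on k S f" "Ck_on k S g" using Suc.prems Ck_on_SucD by blast+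
  have "Ck_on k S (\<lambda>x. frechet_derivative (\<lambda>x. f x * g x) (at x) v)" for v
    using Suc fg by (subst Ck_on_cong_open[OF \<open>open S\<close>,
       of _ "\<lambda>x. f x * frechet_derivative g (at x) v + frechet_derivative f (at x) v * g x"])
         (auto simp: frechet_derivative_eqI[OF d] intro!: Ck_on_add \<open>open S\<close>)
  then show ?case using d differentiableI by auto blast
qed

lemma Ck_on_sum:
  assumes "open S" "\<And>i. i \<in> I \<Longrightarrow> Ck_on k S (f i)"
  shows "Ck_on k S (\<lambda>x. \<Sum>i\<in>I. f i x)"
  using assms by (induction I rule: infinite_finite_induct) (auto intro: Ck_on_const Ck_on_add)

text \<open>\<open>Ck_on\<close> speaks of derivatives in a fixed direction, but in the chain rule
  the direction fed to the derivative of f moves with x. Expanding it in the basis leaves fixed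
  directions with varying coefficients, to which products and sums apply.\<close>

lemma Ck_on_compose:
  fixes g :: "'e::real_normed_vector \<Rightarrow> 'b::euclidean_space" and f :: "'b \<Rightarrow> real"
  assumes "open S" "Ck_on k S g" "Ck_on k T f" "g ` S \<subseteq> T"
  shows "Ck_on k S (\<lambda>x. f (g x))"
  using assms(2,3)
proof (induction k arbitrary: f)
  case 0
  then show ?case using continuous_on_compose2[of T f S g] assms(4) by auto
next
  case (Suc k)
  have d: "((\<lambda>x. f (g x)) has_derivative
      (\<lambda>v. frechet_derivative f (at (g x)) (frechet_derivative g (at x) v))) (at x)"
    if "x \<in> S" for x
    by (rule has_derivative_compose)
       (use Suc.prems that assms(4) in \<open>auto simp: frechet_derivative_works[symmetric]\<close>)
  have expand: "frechet_derivative (\<lambda>x. f (g x)) (at x) v =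
     (\<Sum>i\<in>Basis. (frechet_derivative g (at x) v \<bullet> i) * frechet_derivative f (at (g x)) i)"
    if "x \<in> S" for x v
  proof -
    have "f differentiable (at (g x))" using Suc.prems that assms(4) by auto
    then have "linear (frechet_derivative f (at (g x)))" by (rule linear_frechet_derivative)
    then show ?thesis
      unfolding frechet_derivative_eqI[OF d[OF that]]
      by (subst (1) euclidean_representation[symmetric, of "frechet_derivative g (at x) v"])
         (simp add: linear_sum linear_cmul)
  qed
  have g: "Ck_on k S g" using Suc.prems Ck_on_SucD by blast
  have "Ck_on k S (\<lambda>x. frechet_derivative (\<lambda>x. f (g x)) (at x) v)" for v
  proof (subst Ck_on_cong_open[OF \<open>open S\<close> expand])
    show "Ck_on k S (\<lambda>x. \<Sum>i\<in>Basis. (frechet_derivative g (at x) v \<bullet> i) *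
        frechet_derivative f (at (g x)) i)"
    proof (intro Ck_on_sum Ck_on_mult \<open>open S\<close>)
      fix i :: 'b
      show "Ck_on k S (\<lambda>x. frechet_derivative g (at x) v \<bullet> i)"
        by (rule Ck_on_bounded_linear_compose[OF bounded_linear_inner_left \<open>open S\<close>])
           (use Suc.prems in auto)
      show "Ck_on k S (\<lambda>x. frechet_derivative f (at (g x)) i)"
        using Suc.IH[of "\<lambda>y. frechet_derivative f (at y) i"] g Suc.prems by auto
    qed
  qed auto
  then show ?case using d differentiableI by auto blast
qed

subsection \<open>Bump functions\<close>

text \<open>The derivative of each member of this family is a linear combination of two others, so all of
  them are smooth at once.\<close>

definition flat_exp :: "nat \<Rightarrow> real \<Rightarrow> real" where
  "flat_exp m t = (if t > 0 then exp (- 1 / t) / t ^ m else 0)"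

lemma flat_exp_has_derivative:
  "(flat_exp m has_real_derivative (flat_exp (m + 2) t - real m * flat_exp (m + 1) t)) (at t)"
proof -
  consider "t > 0" | "t < 0" | "t = 0" by linarith
  then show ?thesis
  proof cases
    case 1
    have "((\<lambda>t. exp (- 1 / t) / t ^ m) has_real_derivative
        (flat_exp (m + 2) t - real m * flat_exp (m + 1) t)) (at t)"
    \<comment> \<open>Writing a positive m as a successor keeps the truncated \<open>m - 1\<close>
      out of the power rule.\<close>
    proof (cases m)
      case 0
      then show ?thesis
        using 1 by (auto intro!: derivative_eq_intros simp: flat_exp_def field_simps power2_eq_square)
    next
      case (Suc l)
      have "((\<lambda>t. exp (- 1 / t) / t ^ m) has_real_derivative
        ((exp (- 1 / t) / t ^ 2) * t ^ m - exp (- 1 / t) * (real m * t ^ l)) / (t ^ m * t ^ m)) (at t)"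
      proof (rule DERIV_divide)
        show "((\<lambda>t. exp (- 1 / t)) has_real_derivative exp (- 1 / t) / t ^ 2) (at t)"
          using 1 by (auto intro!: derivative_eq_intros simp: power2_eq_square)
        show "((\<lambda>t. t ^ m) has_real_derivative real m * t ^ l) (at t)"
          using DERIV_pow[of m t] by (simp add: Suc)
      qed (use 1 in auto)
      also have "((exp (- 1 / t) / t ^ 2) * t ^ m - exp (- 1 / t) * (real m * t ^ l)) / (t ^ m * t ^ m)
          = flat_exp (m + 2) t - real m * flat_exp (m + 1) t"
        using 1 by (simp add: flat_exp_def Suc diff_divide_distrib) (simp add: field_simps power2_eq_square)
      finally show ?thesis .
    qed
    then show ?thesis
      by (rule has_field_derivative_transform_within_open[where S = "{0<..}"])
         (use 1 in \<open>auto simp: flat_exp_def\<close>)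
  next
    case 2
    have "((\<lambda>t. 0) has_real_derivative 0) (at t)" by simp
    then have "(flat_exp m has_real_derivative 0) (at t)"
      by (rule has_field_derivative_transform_within_open[where S = "{..<0}"])
         (use 2 in \<open>auto simp: flat_exp_def\<close>)
    then show ?thesis using 2 by (simp add: flat_exp_def)
  next
    case 3
    \<comment> \<open>At 0 the difference quotient is again a member of the family, so
      differentiability there reduces to a one-sided limit at 0.\<close>
    have "(\<lambda>h. flat_exp m h / h) = (\<lambda>h. flat_exp (Suc m) h)"
      by (auto simp: flat_exp_def fun_eq_iff)
    moreover have "((\<lambda>h. flat_exp (Suc m) h) \<longlongrightarrow> 0) (at_right 0)"
    proof -
      have "((\<lambda>t. exp (- 1 / t) / t ^ Suc m) \<longlongrightarrow> (0::real)) (at_right 0)"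
        by real_asymp
      then show ?thesis
        by (rule Lim_transform_eventually)
           (auto simp: eventually_at_filter flat_exp_def)
    qed
    moreover have "((\<lambda>h. flat_exp (Suc m) h) \<longlongrightarrow> 0) (at_left 0)"
      by (rule Lim_transform_eventually[of "\<lambda>_. 0"])
         (auto simp: eventually_at_filter flat_exp_def)
    ultimately have "((\<lambda>h. flat_exp m h / h) \<longlongrightarrow> 0) (at 0)"
      using filterlim_split_at by metis
    then show ?thesis using 3 by (simp add: DERIV_def flat_exp_def)
  qed
qed

lemma Ck_on_flat_exp: "Ck_on k UNIV (flat_exp m)"
proof (induction k arbitrary: m)
  case 0
  then show ?case
    using flat_exp_has_derivative DERIV_isCont continuous_at_imp_continuous_on by (simp, blast)
next
  case (Suc k)
  have d: "(flat_exp m has_derivative (\<lambda>v. (flat_exp (m + 2) t - real m * flat_exp (m + 1) t) * v)) (at t)" for t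
    using flat_exp_has_derivative[of m t] unfolding has_field_derivative_def .
  have "Ck_on k UNIV (\<lambda>t. frechet_derivative (flat_exp m) (at t) v)" for v
  proof -
    have "Ck_on k UNIV (\<lambda>t. (flat_exp (m + 2) t + (- real m) * flat_exp (m + 1) t) * v)"
      by (intro Ck_on_mult Ck_on_add Ck_on_const open_UNIV Suc.IH)
    then show ?thesis by (simp add: frechet_derivative_eqI[OF d])
  qed
  moreover have "flat_exp m differentiable (at t)" for t
    using d by (rule differentiableI)
  ultimately show ?case by simp
qed

lemma smooth_bump_exists:
  fixes a :: "'e::euclidean_space"
  assumes "open S" "a \<in> S"
  obtains b :: "'e \<Rightarrow> real" and K where
    "smooth_on UNIV b" "compact K" "K \<subseteq> S" "\<And>x. x \<notin> K \<Longrightarrow> b x = 0" "b a \<noteq> 0"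
proof -
  obtain r where r: "r > 0" "cball a r \<subseteq> S"
    using assms open_contains_cball by blast
  \<comment> \<open>This is positive exactly on the open ball of radius r, so
    \<open>flat_exp 0\<close> of it vanishes off the closed ball. The squared norm stays smooth at
    the centre.\<close>
  define q where "q x = r\<^sup>2 - (x - a) \<bullet> (x - a)" for x
  define b where "b x = flat_exp 0 (q x)" for x
  \<comment> \<open>A polynomial in the coordinates, built from linear maps, products and sums, for
    which \<open>Ck_on\<close> is already known.\<close>
  have q: "q = (\<lambda>x. (r\<^sup>2 - a \<bullet> a) + (\<Sum>i\<in>Basis. (x \<bullet> i) * (2 * (a \<bullet> i)) + (x \<bullet> i) * ((-1) * (x \<bullet> i))))"
  proof
    fix x
    have "(x - a) \<bullet> (x - a) = a \<bullet> a - 2 * (x \<bullet> a) + x \<bullet> x"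
      by (simp add: algebra_simps inner_commute)
    moreover have "(\<Sum>i\<in>Basis. (x \<bullet> i) * (2 * (a \<bullet> i)) + (x \<bullet> i) * ((-1) * (x \<bullet> i)))
        = (\<Sum>i\<in>Basis. 2 * ((x \<bullet> i) * (a \<bullet> i)) - (x \<bullet> i) * (x \<bullet> i))"
      by (rule sum.cong) auto
    moreover have "\<dots> = 2 * (x \<bullet> a) - x \<bullet> x"
      by (simp only: sum_subtractf euclidean_inner[of x a] euclidean_inner[of x x] sum_distrib_left)
    ultimately show "q x = (r\<^sup>2 - a \<bullet> a) + (\<Sum>i\<in>Basis. (x \<bullet> i) * (2 * (a \<bullet> i)) + (x \<bullet> i) * ((-1) * (x \<bullet> i)))"
      by (simp add: q_def)
  qed
  have "Ck_on k UNIV q" for k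
  proof -
    have lin: "Ck_on k UNIV (\<lambda>x. x \<bullet> i)" for i :: 'e
      by (rule Ck_on_bounded_linear[OF bounded_linear_inner_left])
    have summand: "Ck_on k UNIV (\<lambda>x. (x \<bullet> i) * (2 * (a \<bullet> i)) + (x \<bullet> i) * ((-1) * (x \<bullet> i)))"
      for i :: 'e
      by (rule Ck_on_add[OF open_UNIV Ck_on_mult[OF open_UNIV lin Ck_on_const]
            Ck_on_mult[OF open_UNIV lin Ck_on_mult[OF open_UNIV Ck_on_const lin]]])
    show ?thesis
      unfolding q by (rule Ck_on_add[OF open_UNIV Ck_on_const Ck_on_sum[OF open_UNIV summand]])
  qed
  then have "smooth_on UNIV b"
    unfolding smooth_on_def b_def by (intro allI Ck_on_compose[OF open_UNIV _ Ck_on_flat_exp subset_UNIV]) auto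
  moreover have "b x = 0" if "x \<notin> cball a r" for x
  proof -
    have "norm (x - a) > r" using that by (simp add: dist_norm norm_minus_commute)
    then have "(norm (x - a))\<^sup>2 > r\<^sup>2" using r by (intro power_strict_mono) auto
    then show ?thesis by (simp add: b_def q_def flat_exp_def power2_norm_eq_inner)
  qed
  moreover have "b a \<noteq> 0" using r by (simp add: b_def q_def flat_exp_def)
  ultimately show ?thesis using that r compact_cball by blast
qed

section \<open>Tangent vectors and vector fields on a manifold\<close>

locale smooth_manifold =
  fixes A :: "('a::{t2_space,second_countable_topology}, 'n::finite) chart set"
  assumes atlas: "smooth_atlas A"
begin

section \<open>Charts and the algebra of smooth functions\<close>

lemma chart_exists: obtains c where "c \<in> A" "p \<in> fst c"
  using atlas unfolding smooth_atlas_def by blast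

lemma
  assumes "c \<in> A"
  shows open_chart: "open (fst c)"
    and open_chart_image: "open (snd c ` fst c)"
    and chart_homeomorphism: "homeomorphism (fst c) (snd c ` fst c) (snd c) (chart_inv c)"
  using assms atlas unfolding smooth_atlas_def by blast+

lemma chart_inv_left [simp]: "c \<in> A \<Longrightarrow> q \<in> fst c \<Longrightarrow> chart_inv c (snd c q) = q"
  using chart_homeomorphism homeomorphism_apply1 by blast

lemma open_chart_subimage:
  assumes "c \<in> A" "open U"
  shows "open (snd c ` (fst c \<inter> U))"
proof -
  have "openin (top_of_set (snd c ` fst c)) (snd c ` (fst c \<inter> U))"
    using chart_homeomorphism[OF assms(1)] assms(2)
    by (intro homeomorphism_imp_open_map) auto
  then show ?thesis
    using open_chart_image[OF assms(1)] openin_open_trans by blast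
qed

lemma smooth_on_transition:
  "c \<in> A \<Longrightarrow> d \<in> A \<Longrightarrow> smooth_on (snd c ` (fst c \<inter> fst d)) (snd d \<circ> chart_inv c)"
  using atlas unfolding smooth_atlas_def by blast

lemma smooth_functions_const: "(\<lambda>_. a) \<in> smooth_functions A"
  by (simp add: smooth_functions_def smooth_on_def comp_def Ck_on_const)

lemma smooth_functions_add:
  "f \<in> smooth_functions A \<Longrightarrow> h \<in> smooth_functions A \<Longrightarrow> f + h \<in> smooth_functions A"
  by (simp add: smooth_functions_def smooth_on_def comp_def Ck_on_add open_chart_image)

lemma smooth_functions_mult:
  "f \<in> smooth_functions A \<Longrightarrow> h \<in> smooth_functions A \<Longrightarrow> f * h \<in> smooth_functions A"
  by (simp add: smooth_functions_def smooth_on_def comp_def Ck_on_mult open_chart_image)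

lemma smooth_functions_uminus: "f \<in> smooth_functions A \<Longrightarrow> - f \<in> smooth_functions A"
  using smooth_functions_mult[OF smooth_functions_const[of "-1"], of f]
  by (simp add: fun_Compl_def times_fun_def)

lemma smooth_functions_diff:
  "f \<in> smooth_functions A \<Longrightarrow> h \<in> smooth_functions A \<Longrightarrow> f - h \<in> smooth_functions A"
  using smooth_functions_add[of f "- h"] smooth_functions_uminus by simp

lemma smooth_has_derivative:
  assumes "f \<in> smooth_functions A" "c \<in> A" "p \<in> fst c"
  shows "(f \<circ> chart_inv c has_derivative
           frechet_derivative (f \<circ> chart_inv c) (at (snd c p))) (at (snd c p))"
proof -
  have "Ck_on 1 (snd c ` fst c) (f \<circ> chart_inv c)"
    using assms unfolding smooth_functions_def smooth_on_def by blast
  then show ?thesis using assms(3) by (auto simp: frechet_derivative_works[symmetric])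
qed

section \<open>Tangent spaces as vector spaces\<close>

lemma coord_vec_linear:
  assumes "c \<in> A" "p \<in> fst c"
  shows "coord_vec A c p (v + w) = coord_vec A c p v + coord_vec A c p w"
    and "coord_vec A c p (a *\<^sub>R w) = a *\<^sub>T coord_vec A c p w"
proof -
  have "linear (frechet_derivative (f \<circ> chart_inv c) (at (snd c p)))"
    if "f \<in> smooth_functions A" for f
    using smooth_has_derivative[OF that assms] by (rule has_derivative_linear)
  then show "coord_vec A c p (v + w) = coord_vec A c p v + coord_vec A c p w"
    and "coord_vec A c p (a *\<^sub>R w) = a *\<^sub>T coord_vec A c p w"
    by (auto simp: coord_vec_def scale_tvec_def fun_eq_iff linear_add linear_cmul)
qed

text \<open>Chain rule for the transition map, which is differentiable at the point because charts
  overlap in an open set.\<close>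

lemma coord_vec_change:
  assumes "c \<in> A" "d \<in> A" "p \<in> fst c" "p \<in> fst d"
  shows "coord_vec A d p w =
    coord_vec A c p (frechet_derivative (snd c \<circ> chart_inv d) (at (snd d p)) w)"
proof -
  let ?\<tau> = "snd c \<circ> chart_inv d" and ?x = "snd d p"
  let ?W = "snd d ` (fst d \<inter> fst c)"
  have x: "?x \<in> ?W" using assms by auto
  have W: "open ?W" using open_chart_subimage open_chart assms by blast
  have "Ck_on 1 ?W ?\<tau>"
    using smooth_on_transition[OF assms(2,1)] unfolding smooth_on_def by blast
  then have \<tau>: "(?\<tau> has_derivative frechet_derivative ?\<tau> (at ?x)) (at ?x)"
    using x by (auto simp: frechet_derivative_works[symmetric])
  have "frechet_derivative (f \<circ> chart_inv d) (at ?x) =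
      frechet_derivative (f \<circ> chart_inv c) (at (snd c p)) \<circ> frechet_derivative ?\<tau> (at ?x)"
    if f: "f \<in> smooth_functions A" for f
  proof (rule frechet_derivative_eqI, rule has_derivative_transform_within_open[OF _ W x])
    have "(f \<circ> chart_inv c has_derivative frechet_derivative (f \<circ> chart_inv c) (at (snd c p))) (at (?\<tau> ?x))"
      using smooth_has_derivative[OF f] assms by simp
    from diff_chain_at[OF \<tau> this]
    show "((f \<circ> chart_inv c) \<circ> ?\<tau> has_derivative
       frechet_derivative (f \<circ> chart_inv c) (at (snd c p)) \<circ> frechet_derivative ?\<tau> (at ?x)) (at ?x)" .
    show "((f \<circ> chart_inv c) \<circ> ?\<tau>) y = (f \<circ> chart_inv d) y" if "y \<in> ?W" for y
      using that assms by auto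
  qed
  then show ?thesis by (auto simp: coord_vec_def fun_eq_iff)
qed

text \<open>The definition collects vectors from all charts around p. Closure under addition becomes
  visible only once all of them are written in one chart.\<close>

lemma tangent_space_chart:
  assumes "c \<in> A" "p \<in> fst c"
  shows "tangent_space A p = range (coord_vec A c p)"
proof -
  have "coord_vec A d p w \<in> range (coord_vec A c p)" if "d \<in> A" "p \<in> fst d" for d w
    using coord_vec_change[of c d p w] assms that by simp
  moreover have "coord_vec A c p w \<in> tangent_space A p" for w
    using assms unfolding tangent_space_def by blast
  ultimately show ?thesis unfolding tangent_space_def by blast
qed

lemma tangent_space_add:
  "u \<in> tangent_space A p \<Longrightarrow> v \<in> tangent_space A p \<Longrightarrow> u + v \<in> tangent_space A p"
  by (rule chart_exists[of p]) (auto simp: tangent_space_chart coord_vec_linear(1)[symmetric])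

lemma tangent_space_scale: "u \<in> tangent_space A p \<Longrightarrow> a *\<^sub>T u \<in> tangent_space A p"
  by (rule chart_exists[of p]) (auto simp: tangent_space_chart coord_vec_linear(2)[symmetric])

lemma tangent_space_uminus: "u \<in> tangent_space A p \<Longrightarrow> - u \<in> tangent_space A p"
  using tangent_space_scale[of u p "-1"] by (simp add: scale_tvec_def fun_Compl_def)

lemma tangent_space_diff:
  "u \<in> tangent_space A p \<Longrightarrow> v \<in> tangent_space A p \<Longrightarrow> u - v \<in> tangent_space A p"
  using tangent_space_add[of u p "- v"] tangent_space_uminus by simp

lemma
  assumes "v \<in> tangent_space A p" "f \<in> smooth_functions A" "h \<in> smooth_functions A"
  shows tangent_vector_add: "v (f + h) = v f + v h"
    and tangent_vector_diff: "v (f - h) = v f - v h"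
proof -
  obtain c where c: "c \<in> A" "p \<in> fst c" using chart_exists .
  then obtain w where v: "v = coord_vec A c p w"
    using assms(1) tangent_space_chart by auto
  let ?d = "\<lambda>f. frechet_derivative (f \<circ> chart_inv c) (at (snd c p))"
  note d = smooth_has_derivative[OF assms(2) c] smooth_has_derivative[OF assms(3) c]
  have "(f + h) \<circ> chart_inv c = (\<lambda>x. (f \<circ> chart_inv c) x + (h \<circ> chart_inv c) x)"
       "(f - h) \<circ> chart_inv c = (\<lambda>x. (f \<circ> chart_inv c) x - (h \<circ> chart_inv c) x)" by auto
  then have "?d (f + h) = (\<lambda>v. ?d f v + ?d h v)" "?d (f - h) = (\<lambda>v. ?d f v - ?d h v)"
    using has_derivative_add[OF d] has_derivative_diff[OF d]
    by (simp_all add: frechet_derivative_eqI)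
  then show "v (f + h) = v f + v h" "v (f - h) = v f - v h"
    using assms by (auto simp: v coord_vec_def smooth_functions_add smooth_functions_diff)
qed

lemma tangent_vector_nonsmooth: "v \<in> tangent_space A p \<Longrightarrow> f \<notin> smooth_functions A \<Longrightarrow> v f = 0"
  by (auto simp: tangent_space_def coord_vec_def)

section \<open>Extension by zero and fields with a prescribed value\<close>

lemma smooth_functions_extend_by_zero:
  assumes c: "c \<in> A"
    and u: "smooth_on (snd c ` fst c) u"
    and K: "compact K" "K \<subseteq> snd c ` fst c"
    and zero: "\<And>x. x \<in> snd c ` fst c - K \<Longrightarrow> u x = 0"
  shows "(\<lambda>q. if q \<in> fst c then u (snd c q) else 0) \<in> smooth_functions A" (is "?f \<in> _")
  unfolding smooth_functions_def smooth_on_def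
proof (intro CollectI ballI allI)
  fix d k assume d: "d \<in> A"
  let ?K' = "chart_inv c ` K"
  have "continuous_on (snd c ` fst c) (chart_inv c)"
    using chart_homeomorphism[OF c] by (rule homeomorphism_cont2)
  \<comment> \<open>Compact sets are closed because the manifold is Hausdorff. The chart domain and
    the complement of \<open>?K'\<close> then form an open cover: on the first the function is u in
    coordinates, on the second it is 0.\<close>
  then have "closed ?K'"
    using K by (intro compact_imp_closed compact_continuous_image) (auto intro: continuous_on_subset)
  then have open_compl: "open (- ?K')" by auto
  show "Ck_on k (snd d ` fst d) (?f \<circ> chart_inv d)"
  proof (rule Ck_on_local)
    fix x assume "x \<in> snd d ` fst d"
    then obtain q where q: "q \<in> fst d" "x = snd d q" by auto
    show "\<exists>U. open U \<and> x \<in> U \<and> Ck_on k U (?f \<circ> chart_inv d)"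
    proof (cases "q \<in> fst c")
      case True
      let ?U = "snd d ` (fst d \<inter> fst c)"
      have U: "open ?U" "x \<in> ?U"
        using q True open_chart_subimage[OF d open_chart[OF c]] by auto
      have "Ck_on k ?U (\<lambda>y. u ((snd c \<circ> chart_inv d) y))"
      proof (rule Ck_on_compose[OF U(1), where f = u])
        show "Ck_on k ?U (snd c \<circ> chart_inv d)" "Ck_on k (snd c ` fst c) u"
          using smooth_on_transition[OF d c] u unfolding smooth_on_def by blast+
        show "(snd c \<circ> chart_inv d) ` ?U \<subseteq> snd c ` fst c" using d by auto
      qed
      then have "Ck_on k ?U (?f \<circ> chart_inv d)"
        by (subst Ck_on_cong_open[OF U(1), of _ "\<lambda>y. u ((snd c \<circ> chart_inv d) y)"])
           (use d in auto)
      with U show ?thesis by blast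
    next
      case False
      let ?U = "snd d ` (fst d \<inter> - ?K')"
      have "q \<notin> ?K'" using False K(2) c by auto
      then have U: "open ?U" "x \<in> ?U"
        using q open_chart_subimage[OF d open_compl] by auto
      have "u (snd c r) = 0" if "r \<in> fst c" "r \<notin> ?K'" for r
      proof -
        have "snd c r \<notin> K" using that c by (metis chart_inv_left image_eqI)
        then show ?thesis using zero that by auto
      qed
      then have "Ck_on k ?U (?f \<circ> chart_inv d)"
        by (subst Ck_on_cong_open[OF U(1), of _ "\<lambda>y. 0"]) (use d in \<open>auto simp: Ck_on_const\<close>)
      with U show ?thesis by blast
    qed
  qed
qed

text \<open>The field with constant coordinates w is cut off by a bump function, normalised to 1 at
  p. Existence is what gives the \<open>SOME\<close> in \<open>extend_tvec\<close> its
  meaning.\<close>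

lemma tangent_vector_extension:
  assumes "v \<in> tangent_space A p"
  obtains X where "X \<in> vector_fields A" "X p = v"
proof -
  obtain c where c: "c \<in> A" "p \<in> fst c" using chart_exists .
  obtain w where v: "v = coord_vec A c p w" using assms tangent_space_chart[OF c] by auto
  have "open (snd c ` fst c)" "snd c p \<in> snd c ` fst c" using c open_chart_image by auto
  then obtain b :: "real ^ 'n \<Rightarrow> real" and K where
    b: "smooth_on UNIV b" "compact K" "K \<subseteq> snd c ` fst c" "\<And>x. x \<notin> K \<Longrightarrow> b x = 0" "b (snd c p) \<noteq> 0"
    using smooth_bump_exists by metis
  define X where "X q = (if q \<in> fst c
    then (b (snd c q) / b (snd c p)) *\<^sub>T coord_vec A c q w else 0)" for q
  have "X q \<in> tangent_space A q" for q
  proof (cases "q \<in> fst c")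
    case True
    then show ?thesis
      by (auto simp: X_def tangent_space_chart[OF c(1)] coord_vec_linear(2)[OF c(1), symmetric])
  next
    case False
    obtain d where d: "d \<in> A" "q \<in> fst d" using chart_exists .
    have "0 = coord_vec A d q 0"
      using coord_vec_linear(2)[OF d, of 0 0] by (simp add: scale_tvec_def zero_fun_def)
    then show ?thesis using False by (auto simp: X_def tangent_space_chart[OF d])
  qed
  moreover have "(\<lambda>q. X q f) \<in> smooth_functions A" if f: "f \<in> smooth_functions A" for f
  proof -
    define u where "u x = (b x * inverse (b (snd c p))) * frechet_derivative (f \<circ> chart_inv c) (at x) w" for x
    have "smooth_on (snd c ` fst c) u"
      unfolding smooth_on_def u_def
    proof (intro allI Ck_on_mult Ck_on_const open_chart_image c)
      fix k
      show "Ck_on k (snd c ` fst c) b"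
        using b(1) Ck_on_subset unfolding smooth_on_def by blast
      \<comment> \<open>Applying a field to f costs one derivative, hence the successor.\<close>
      have "Ck_on (Suc k) (snd c ` fst c) (f \<circ> chart_inv c)"
        using f c unfolding smooth_functions_def smooth_on_def by blast
      then show "Ck_on k (snd c ` fst c) (\<lambda>x. frechet_derivative (f \<circ> chart_inv c) (at x) w)"
        by simp
    qed
    then have "(\<lambda>q. if q \<in> fst c then u (snd c q) else 0) \<in> smooth_functions A"
      using smooth_functions_extend_by_zero[OF c(1) _ b(2,3)] b(4) by (simp add: u_def)
    also have "(\<lambda>q. if q \<in> fst c then u (snd c q) else 0) = (\<lambda>q. X q f)"
      using f by (auto simp: X_def u_def scale_tvec_def coord_vec_def divide_inverse fun_eq_iff)
    finally show ?thesis .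
  qed
  ultimately have "X \<in> vector_fields A" by (simp add: vector_fields_def)
  moreover have "X p = v" using c b(5) by (simp add: X_def v scale_tvec_def)
  ultimately show ?thesis using that by blast
qed

lemma
  assumes "v \<in> tangent_space A p"
  shows extend_tvec_in: "extend_tvec A p v \<in> vector_fields A"
    and extend_tvec_at [simp]: "extend_tvec A p v p = v"
proof -
  have "\<exists>X. X \<in> vector_fields A \<and> X p = v" using tangent_vector_extension[OF assms] by blast
  from someI_ex[OF this]
  show "extend_tvec A p v \<in> vector_fields A" "extend_tvec A p v p = v"
    unfolding extend_tvec_def by auto
qed

section \<open>Coordinates of tangent vectors and traces\<close>

lemma coord_vec_eq_0D:
  assumes c: "c \<in> A" "p \<in> fst c" and 0: "coord_vec A c p w = 0"
  shows "w = 0"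
proof -
  have "open (snd c ` fst c)" "snd c p \<in> snd c ` fst c" using c open_chart_image by auto
  then obtain b :: "real ^ 'n \<Rightarrow> real" and K where
    b: "smooth_on UNIV b" "compact K" "K \<subseteq> snd c ` fst c" "\<And>x. x \<notin> K \<Longrightarrow> b x = 0" "b (snd c p) \<noteq> 0"
    using smooth_bump_exists by metis
  \<comment> \<open>The test function is the linear functional dual to w, shifted to vanish at the
    point and cut off by the bump. The zero removes the derivative of b, so the derivative along w
    is a nonzero multiple of the squared norm of w.\<close>
  define u where "u x = b x * (x \<bullet> w + - (snd c p \<bullet> w))" for x
  have u: "smooth_on UNIV u"
    unfolding smooth_on_def u_def
    by (intro allI Ck_on_mult Ck_on_add open_UNIV Ck_on_const Ck_on_bounded_linear[OF bounded_linear_inner_left])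
       (use b(1) in \<open>auto simp: smooth_on_def\<close>)
  let ?f = "\<lambda>q. if q \<in> fst c then u (snd c q) else 0"
  have f: "?f \<in> smooth_functions A"
  proof (rule smooth_functions_extend_by_zero[OF c(1) _ b(2,3)])
    show "smooth_on (snd c ` fst c) u"
      using u Ck_on_subset unfolding smooth_on_def by blast
  qed (use b(4) in \<open>auto simp: u_def\<close>)
  have "frechet_derivative (?f \<circ> chart_inv c) (at (snd c p)) = frechet_derivative u (at (snd c p))"
    by (rule frechet_derivative_cong_open[OF open_chart_image[OF c(1)]]) (use c in auto)
  also have "\<dots> = (\<lambda>h. b (snd c p) * (h \<bullet> w))"
  proof (rule frechet_derivative_eqI)
    have "Ck_on 1 UNIV b" using b(1) unfolding smooth_on_def by blast
    then have "(b has_derivative frechet_derivative b (at (snd c p))) (at (snd c p))"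
      by (simp add: frechet_derivative_works[symmetric])
    then show "(u has_derivative (\<lambda>h. b (snd c p) * (h \<bullet> w))) (at (snd c p))"
      unfolding u_def by (auto intro!: derivative_eq_intros)
  qed
  finally have "coord_vec A c p w ?f = b (snd c p) * (w \<bullet> w)"
    using f by (simp add: coord_vec_def)
  then show ?thesis using 0 b(5) by simp
qed

text \<open>A trivial kernel and linearity make coordinates unique, as the \<open>THE\<close> in
  \<open>coords\<close> requires.\<close>

lemma coords_coord_vec:
  assumes c: "c \<in> A" "p \<in> fst c"
  shows "coords A c p (coord_vec A c p w) = w"
  unfolding coords_def
proof (rule the_equality)
  fix w' assume "coord_vec A c p w' = coord_vec A c p w"
  moreover have "coord_vec A c p w' = coord_vec A c p (w' - w) + coord_vec A c p w"
    by (simp flip: coord_vec_linear(1)[OF c])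
  ultimately have "coord_vec A c p (w' - w) = 0" by simp
  then show "w' = w" using coord_vec_eq_0D[OF c] by fastforce
qed simp

text \<open>The rank-one map sending u to a(u) v has trace a(v), and the identity has trace n.
  Applied with a = eta and k = 2, this yields the Ricci tensor on xi.\<close>

lemma tangent_trace_wedge:
  fixes a :: "'a tvec \<Rightarrow> real"
  assumes lin: "\<And>u v r. u \<in> tangent_space A p \<Longrightarrow> v \<in> tangent_space A p \<Longrightarrow>
      a (u + v) = a u + a v \<and> a (r *\<^sub>T u) = r * a u"
    and v: "v \<in> tangent_space A p"
    and E: "\<And>u. u \<in> tangent_space A p \<Longrightarrow> E u = k *\<^sub>T (a u *\<^sub>T v - a v *\<^sub>T u)"
  shows "tangent_trace A p E = k * (1 - real CARD('n)) * a v"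
proof -
  define c where "c = (SOME c. c \<in> A \<and> p \<in> fst c)"
  have "\<exists>c. c \<in> A \<and> p \<in> fst c" using chart_exists by metis
  from someI_ex[OF this] have c: "c \<in> A" "p \<in> fst c" by (auto simp: c_def)
  obtain w where w: "v = coord_vec A c p w" using v tangent_space_chart[OF c] by auto
  let ?e = "\<lambda>i. coord_vec A c p (axis i 1)"
  have e: "coord_vec A c p x \<in> tangent_space A p" for x using tangent_space_chart[OF c] by auto
  have "coords A c p (E (?e i)) $ i = k * (a (?e i) * w $ i - a v)" for i
  proof -
    have "E (?e i) = coord_vec A c p (k *\<^sub>R (a (?e i) *\<^sub>R w + (- a v) *\<^sub>R axis i 1))"
      by (simp only: coord_vec_linear[OF c] E[OF e] w[symmetric])
         (simp add: scale_tvec_def fun_eq_iff)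
    then show ?thesis by (simp add: coords_coord_vec[OF c])
  qed
  then have "tangent_trace A p E = (\<Sum>i\<in>UNIV. k * (a (?e i) * w $ i - a v))"
    by (simp add: tangent_trace_def Let_def flip: c_def)
  also have "\<dots> = k * ((\<Sum>i\<in>UNIV. w $ i * a (?e i)) - real CARD('n) * a v)"
    by (simp add: sum_distrib_left[symmetric] sum_subtractf mult.commute)
  \<comment> \<open>Expansion of v in the coordinate basis. Linearity of a is assumed on tangent
    vectors only, so the sum is taken apart by induction.\<close>
  also have "(\<Sum>i\<in>UNIV. w $ i * a (?e i)) = a v"
  proof -
    have 0: "a (coord_vec A c p 0) = 0"
      using lin[OF e e, of 0 0 0] by (simp flip: coord_vec_linear[OF c])
    have "a (coord_vec A c p (\<Sum>i\<in>I. w $ i *\<^sub>R axis i 1)) = (\<Sum>i\<in>I. w $ i * a (?e i))" for I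
    proof (induction I rule: infinite_finite_induct)
      case (insert i I)
      then show ?case
        by (simp only: sum.insert[OF insert.hyps] coord_vec_linear[OF c]
              lin[OF tangent_space_scale[OF e] e] lin[OF e e])
    qed (auto simp: 0)
    from this[of UNIV] show ?thesis using basis_expansion[of w] by (simp add: w scalar_mult_eq_scaleR)
  qed
  finally show ?thesis by (simp add: algebra_simps)
qed

section \<open>Vector fields as a module and the Jacobi identity\<close>

lemma vector_fieldsD: "X \<in> vector_fields A \<Longrightarrow> X p \<in> tangent_space A p"
  by (simp add: vector_fields_def)

lemma act_smooth: "X \<in> vector_fields A \<Longrightarrow> f \<in> smooth_functions A \<Longrightarrow> act X f \<in> smooth_functions A"
  by (simp add: vector_fields_def act_def)

lemma act_add: "X \<in> vector_fields A \<Longrightarrow> f \<in> smooth_functions A \<Longrightarrow> h \<in> smooth_functions A \<Longrightarrow>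
    act X (f + h) = act X f + act X h"
  by (auto simp: act_def fun_eq_iff tangent_vector_add[OF vector_fieldsD])

lemma vector_fields_add:
  assumes "X \<in> vector_fields A" "Y \<in> vector_fields A" shows "X + Y \<in> vector_fields A"
  using assms smooth_functions_add[of "\<lambda>p. X p f" "\<lambda>p. Y p f" for f] tangent_space_add
  by (auto simp: vector_fields_def) (simp add: plus_fun_def)

lemma vector_fields_scale:
  assumes "h \<in> smooth_functions A" "X \<in> vector_fields A" shows "h *\<^sub>V X \<in> vector_fields A"
  using assms smooth_functions_mult[of h "\<lambda>p. X p f" for f]
  by (auto simp: vector_fields_def tangent_space_scale scale_vfield_def)
     (simp add: scale_tvec_def times_fun_def)

lemma vector_fields_uminus: "X \<in> vector_fields A \<Longrightarrow> - X \<in> vector_fields A"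
  using vector_fields_scale[OF smooth_functions_const[of "-1"], of X]
  by (simp add: scale_vfield_def scale_tvec_def fun_Compl_def)

lemma vector_fields_diff: "X \<in> vector_fields A \<Longrightarrow> Y \<in> vector_fields A \<Longrightarrow> X - Y \<in> vector_fields A"
  using vector_fields_add[of X "- Y"] vector_fields_uminus by simp

text \<open>For smooth f, additivity expands the sum into twelve threefold derivatives of f that
  cancel in pairs.\<close>

lemma lie_bracket_jacobi:
  assumes X: "X \<in> vector_fields A" and Y: "Y \<in> vector_fields A" and Z: "Z \<in> vector_fields A"
  shows "lie_bracket X (lie_bracket Y Z) + lie_bracket Y (lie_bracket Z X)
         + lie_bracket Z (lie_bracket X Y) = 0"
proof (intro ext)
  fix p f
  have act_lie: "act (lie_bracket U V) f = act U (act V f) - act V (act U f)" for U V f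
    by (auto simp: lie_bracket_def act_def)
  show "(lie_bracket X (lie_bracket Y Z) + lie_bracket Y (lie_bracket Z X)
         + lie_bracket Z (lie_bracket X Y)) p f = 0 p f"
  proof (cases "f \<in> smooth_functions A")
    case True
    then show ?thesis
      by (simp add: lie_bracket_def[of _ "lie_bracket _ _"] act_lie X Y Z act_smooth
            tangent_vector_diff[OF vector_fieldsD])
         (simp add: lie_bracket_def)
  next
    case False
    \<comment> \<open>By convention tangent vectors are 0 on nonsmooth functions, so every term is a
      vector applied to the zero function.\<close>
    have zero: "act U f = (\<lambda>_. 0)" if "U \<in> vector_fields A" for U
      using that False by (auto simp: act_def tangent_vector_nonsmooth[OF vector_fieldsD])
    have z: "U p (\<lambda>_. 0) = 0" if "U \<in> vector_fields A" for U p
      using tangent_vector_diff[OF vector_fieldsD[OF that] smooth_functions_const[of 0] smooth_functions_const[of 0]]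
      by (simp add: zero_fun_def)
    then have "act U (\<lambda>_. 0) = (\<lambda>_. 0)" if "U \<in> vector_fields A" for U
      using that by (auto simp: act_def)
    then show ?thesis
      by (simp add: lie_bracket_def[of _ "lie_bracket _ _"] act_lie X Y Z zero z fun_diff_def)
         (simp add: lie_bracket_def X Y Z zero z)
  qed
qed

end

section \<open>Metric connections\<close>

lemma fun2_eq_iff: "X = Y \<longleftrightarrow> (\<forall>p f. X p f = Y p f)"
  by (auto simp: fun_eq_iff)

context smooth_manifold
begin

lemma coords_linear:
  assumes c: "c \<in> A" "p \<in> fst c" and "u \<in> tangent_space A p" "v \<in> tangent_space A p"
  shows "coords A c p (a *\<^sub>T u + v) = a *\<^sub>R coords A c p u + coords A c p v"
proof -
  obtain x y where xy: "u = coord_vec A c p x" "v = coord_vec A c p y"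
    using assms tangent_space_chart[OF c] by auto
  have "a *\<^sub>T u + v = coord_vec A c p (a *\<^sub>R x + y)"
    by (simp only: xy coord_vec_linear[OF c])
  then show ?thesis by (simp only: xy coords_coord_vec[OF c])
qed

text \<open>Gives linearity of the Ricci tensor in its last argument. The hypotheses are restricted
  to tangent vectors, where \<open>coords\<close> is meaningful.\<close>

lemma tangent_trace_linear:
  assumes "\<And>u. u \<in> tangent_space A p \<Longrightarrow> E1 u \<in> tangent_space A p"
    and "\<And>u. u \<in> tangent_space A p \<Longrightarrow> E2 u \<in> tangent_space A p"
    and "\<And>u. u \<in> tangent_space A p \<Longrightarrow> E u = a *\<^sub>T E1 u + E2 u"
  shows "tangent_trace A p E = a * tangent_trace A p E1 + tangent_trace A p E2"
proof -
  define c where "c = (SOME c. c \<in> A \<and> p \<in> fst c)"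
  have "\<exists>c. c \<in> A \<and> p \<in> fst c" using chart_exists by metis
  from someI_ex[OF this] have c: "c \<in> A" "p \<in> fst c" by (auto simp: c_def)
  have "coord_vec A c p x \<in> tangent_space A p" for x using tangent_space_chart[OF c] by auto
  then show ?thesis
    using assms coords_linear[OF c]
    by (simp add: tangent_trace_def Let_def sum.distrib sum_distrib_left flip: c_def)
qed

end

locale riemannian_manifold = smooth_manifold A
  for A :: "('a::{t2_space,second_countable_topology}, 'n::finite) chart set" +
  fixes g :: "'a \<Rightarrow> 'a tvec \<Rightarrow> 'a tvec \<Rightarrow> real"
  assumes metric: "riemannian_metric A g"
begin

lemma g_add_left:
  assumes "u \<in> tangent_space A p" "v \<in> tangent_space A p" "w \<in> tangent_space A p"
  shows "g p (u + v) w = g p u w + g p v w"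
  using metric assms unfolding riemannian_metric_def by blast

lemma
  assumes "u \<in> tangent_space A p" "v \<in> tangent_space A p"
  shows g_scale_left: "g p (a *\<^sub>T u) v = a * g p u v"
    and g_sym: "g p u v = g p v u"
  using metric assms unfolding riemannian_metric_def by blast+

lemma g_pos: "u \<in> tangent_space A p \<Longrightarrow> u \<noteq> 0 \<Longrightarrow> g p u u > 0"
  using metric unfolding riemannian_metric_def by blast

lemma g_diff_left:
  assumes "u \<in> tangent_space A p" "v \<in> tangent_space A p" "w \<in> tangent_space A p"
  shows "g p (u - v) w = g p u w - g p v w"
  using g_add_left[of "u - v" p v w] assms tangent_space_diff by simp

text \<open>Test with a field extending u - v and use positivity. The test objects are fields
  because the curvature identities are proved for fields.\<close>

lemma g_nondegenerate:
  assumes "u \<in> tangent_space A p" "v \<in> tangent_space A p"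
    and "\<And>W. W \<in> vector_fields A \<Longrightarrow> g p u (W p) = g p v (W p)"
  shows "u = v"
proof -
  have uv: "u - v \<in> tangent_space A p" using assms tangent_space_diff by blast
  have "g p u (u - v) = g p v (u - v)"
    using assms(3)[OF extend_tvec_in[OF uv]] uv by simp
  then have "g p (u - v) (u - v) = 0" using g_diff_left assms uv by simp
  then show ?thesis using g_pos[OF uv] by fastforce
qed

lemma ev2_smooth: "X \<in> vector_fields A \<Longrightarrow> Y \<in> vector_fields A \<Longrightarrow> ev2 g X Y \<in> smooth_functions A"
  using metric unfolding riemannian_metric_def by blast

lemma ev2_sym:
  assumes "X \<in> vector_fields A" "Y \<in> vector_fields A"
  shows "ev2 g X Y = ev2 g Y X"
  using assms g_sym vector_fieldsD by (fastforce simp: ev2_def)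

lemma ev2_scale_left:
  assumes "X \<in> vector_fields A" "Y \<in> vector_fields A"
  shows "ev2 g (h *\<^sub>V X) Y = h * ev2 g X Y"
  using assms by (auto simp: ev2_def fun_eq_iff scale_vfield_def g_scale_left vector_fieldsD)

lemma
  assumes "X \<in> vector_fields A" "Y \<in> vector_fields A" "Z \<in> vector_fields A"
  shows ev2_add_left: "ev2 g (X + Y) Z = ev2 g X Z + ev2 g Y Z"
    and ev2_diff_left: "ev2 g (X - Y) Z = ev2 g X Z - ev2 g Y Z"
  using assms by (auto simp: ev2_def fun_eq_iff g_add_left g_diff_left vector_fieldsD)

lemma ev2_zero_left: "X \<in> vector_fields A \<Longrightarrow> ev2 g 0 X = 0"
  using ev2_diff_left[of X X X] by simp

lemma ev2_scale_right:
  assumes "X \<in> vector_fields A" "Y \<in> vector_fields A" "h \<in> smooth_functions A"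
  shows "ev2 g Y (h *\<^sub>V X) = h * ev2 g Y X"
  using assms ev2_scale_left ev2_sym vector_fields_scale by metis

lemma
  assumes "X \<in> vector_fields A" "Y \<in> vector_fields A" "Z \<in> vector_fields A"
  shows ev2_add_right: "ev2 g Z (X + Y) = ev2 g Z X + ev2 g Z Y"
    and ev2_diff_right: "ev2 g Z (X - Y) = ev2 g Z X - ev2 g Z Y"
  using assms ev2_add_left ev2_diff_left ev2_sym vector_fields_add vector_fields_diff by metis+

end

text \<open>Torsion is allowed; a metric connection is only required to be a map on vector fields
  compatible with \<open>g\<close>. Compatibility makes the curvature skew in the last two slots, and this
  alone yields its tensoriality and linearity in the third argument.\<close>

locale metric_connection = riemannian_manifold A g
  for A :: "('a::{t2_space,second_countable_topology}, 'n::finite) chart set" and g +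
  fixes E :: "'a connection"
  assumes connection_closed:
      "X \<in> vector_fields A \<Longrightarrow> Y \<in> vector_fields A \<Longrightarrow> E X Y \<in> vector_fields A"
    and lie_bracket_closed:
      "X \<in> vector_fields A \<Longrightarrow> Y \<in> vector_fields A \<Longrightarrow> lie_bracket X Y \<in> vector_fields A"
    and compatible: "X \<in> vector_fields A \<Longrightarrow> Y \<in> vector_fields A \<Longrightarrow> Z \<in> vector_fields A \<Longrightarrow>
      act X (ev2 g Y Z) = ev2 g (E X Y) Z + ev2 g Y (E X Z)"
begin

lemma curvature_closed:
  assumes "X \<in> vector_fields A" "Y \<in> vector_fields A" "Z \<in> vector_fields A"
  shows "curvature E X Y Z \<in> vector_fields A"
  by (simp add: curvature_def assms connection_closed lie_bracket_closed vector_fields_diff)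

text \<open>Apply X Y - Y X - [X,Y] = 0 to the function g(Z,W) and differentiate by compatibility
  twice. The mixed terms, with one derivative on each of Z and W, are symmetric in X and Y and drop
  out.\<close>

lemma curvature_skew:
  assumes X: "X \<in> vector_fields A" and Y: "Y \<in> vector_fields A"
    and Z: "Z \<in> vector_fields A" and W: "W \<in> vector_fields A"
  shows "ev2 g (curvature E X Y Z) W = - ev2 g (curvature E X Y W) Z"
proof -
  note vf = X Y Z W connection_closed lie_bracket_closed vector_fields_diff
  have second: "act U (act V (ev2 g Z W)) =
      ev2 g (E U (E V Z)) W + ev2 g (E V Z) (E U W) + (ev2 g (E U Z) (E V W) + ev2 g Z (E U (E V W)))"
    if "U \<in> vector_fields A" "V \<in> vector_fields A" for U V
    by (simp only: compatible that vf act_add ev2_smooth)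
  have "act (lie_bracket X Y) (ev2 g Z W) = act X (act Y (ev2 g Z W)) - act Y (act X (ev2 g Z W))"
    by (auto simp: lie_bracket_def act_def)
  then have *: "ev2 g (E (lie_bracket X Y) Z) W + ev2 g Z (E (lie_bracket X Y) W) =
     act X (act Y (ev2 g Z W)) - act Y (act X (ev2 g Z W))"
    by (simp only: compatible vf)
  have "ev2 g (curvature E X Y W) Z = ev2 g Z (curvature E X Y W)"
    by (rule ev2_sym) (simp_all add: curvature_closed vf)
  then show ?thesis
    using * unfolding second[OF X Y] second[OF Y X]
    by (simp add: curvature_def ev2_diff_left ev2_diff_right vf)
       (simp add: algebra_simps eq_neg_iff_add_eq_0)
qed

lemma curvature_linear:
  assumes X: "X \<in> vector_fields A" and Y: "Y \<in> vector_fields A"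
    and Z: "Z \<in> vector_fields A" and Z1: "Z1 \<in> vector_fields A" and Z2: "Z2 \<in> vector_fields A"
    and p: "Z p = a *\<^sub>T Z1 p + Z2 p"
  shows "curvature E X Y Z p = a *\<^sub>T curvature E X Y Z1 p + curvature E X Y Z2 p"
proof (rule g_nondegenerate)
  note R = curvature_closed[OF X Y, THEN vector_fieldsD]
  note vf = R[OF Z] R[OF Z1] R[OF Z2] Z1 Z2 vector_fieldsD tangent_space_add tangent_space_scale
  show "curvature E X Y Z p \<in> tangent_space A p"
    "a *\<^sub>T curvature E X Y Z1 p + curvature E X Y Z2 p \<in> tangent_space A p"
    by (simp_all add: vf)
  fix W assume W: "W \<in> vector_fields A"
  \<comment> \<open>After the swap U is no longer differentiated, so the value \<open>U p\<close> is
    all that matters.\<close>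
  have skew: "g p (curvature E X Y U p) (W p) = - g p (U p) (curvature E X Y W p)"
    if U: "U \<in> vector_fields A" for U
  proof -
    have "g p (curvature E X Y U p) (W p) = - g p (curvature E X Y W p) (U p)"
      using fun_cong[OF curvature_skew[OF X Y U W], of p] by (simp add: ev2_def)
    then show ?thesis using g_sym R U W vector_fieldsD by metis
  qed
  show "g p (curvature E X Y Z p) (W p) =
      g p (a *\<^sub>T curvature E X Y Z1 p + curvature E X Y Z2 p) (W p)"
    by (simp only: skew[OF Z] p g_add_left g_scale_left vf R[OF W] vector_fieldsD[OF W]
          skew[OF Z1] skew[OF Z2])
qed

lemma curvature_tensorial:
  assumes "X \<in> vector_fields A" "Y \<in> vector_fields A" "Z \<in> vector_fields A" "Z' \<in> vector_fields A"
    and "Z p = Z' p"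
  shows "curvature E X Y Z p = curvature E X Y Z' p"
  \<comment> \<open>Coefficient 0, with \<open>Z'\<close> filling both places of the linear
    combination.\<close>
  using curvature_linear[OF assms(1-4,4), of p 0] assms(5)
  by (simp add: scale_tvec_def flip: zero_fun_def)

lemma curvature_at_in:
  assumes "u \<in> tangent_space A p" "v \<in> tangent_space A p" "w \<in> tangent_space A p"
  shows "curvature_at A E p u v w \<in> tangent_space A p"
  unfolding curvature_at_def using assms curvature_closed extend_tvec_in vector_fieldsD by blast

text \<open>The extension chosen for the combination is unrelated to those chosen for
  \<open>w1\<close> and \<open>w2\<close>; they match only at p. Hence
  \<open>curvature_linear\<close> assumes its relation at a single point.\<close>

lemma curvature_at_linear:
  assumes "u \<in> tangent_space A p" "v \<in> tangent_space A p"
    "w1 \<in> tangent_space A p" "w2 \<in> tangent_space A p"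
  shows "curvature_at A E p u v (a *\<^sub>T w1 + w2) =
    a *\<^sub>T curvature_at A E p u v w1 + curvature_at A E p u v w2"
  unfolding curvature_at_def using assms
  by (intro curvature_linear extend_tvec_in) (auto simp: tangent_space_add tangent_space_scale)

lemma projective_curvature_at_linear:
  assumes "u \<in> tangent_space A p" "v \<in> tangent_space A p"
    "w1 \<in> tangent_space A p" "w2 \<in> tangent_space A p"
  shows "projective_curvature_at A E p u v (a *\<^sub>T w1 + w2) =
    a *\<^sub>T projective_curvature_at A E p u v w1 + projective_curvature_at A E p u v w2"
proof -
  have ricci: "ricci_at A E p v (a *\<^sub>T w1 + w2) = a * ricci_at A E p v w1 + ricci_at A E p v w2"
    if "v \<in> tangent_space A p" for v
    unfolding ricci_at_def
    by (rule tangent_trace_linear) (use assms that curvature_at_linear curvature_at_in in auto)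
  show ?thesis
    unfolding projective_curvature_at_def
    by (simp only: ricci assms curvature_at_linear) (auto simp: scale_tvec_def algebra_simps)
qed

end

section \<open>Para-Sasakian manifolds\<close>

locale para_sasakian_manifold =
  fixes A :: "('a::{t2_space,second_countable_topology}, 'n::finite) chart set"
    and \<phi> :: "'a \<Rightarrow> 'a tvec \<Rightarrow> 'a tvec"
    and \<xi> :: "'a vfield"
    and \<eta> :: "'a \<Rightarrow> 'a tvec \<Rightarrow> real"
    and g :: "'a \<Rightarrow> 'a tvec \<Rightarrow> 'a tvec \<Rightarrow> real"
    and D :: "'a connection"
  assumes para_sasakian: "para_sasakian A \<phi> \<xi> \<eta> g D"
begin

lemma levi_civita: "levi_civita A g D"
  and endomorphism_field: "endomorphism_field A \<phi>"
  and one_form: "one_form A \<eta>"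
  and \<xi>_field: "\<xi> \<in> vector_fields A"
  and \<eta>_\<xi>: "ev1 \<eta> \<xi> = 1"
  and \<phi>_\<xi>: "ev1 \<phi> \<xi> = 0"
  using para_sasakian unfolding para_sasakian_def by blast+

sublocale riemannian_manifold A g
  using para_sasakian by unfold_locales (auto simp: para_sasakian_def)

lemma affine: "affine_connection A D"
  using levi_civita unfolding levi_civita_def by blast

lemma
  assumes "X \<in> vector_fields A" "Y \<in> vector_fields A" "Z \<in> vector_fields A"
  shows D_add_left: "D (X + Y) Z = D X Z + D Y Z"
    and D_add_right: "D X (Y + Z) = D X Y + D X Z"
  using assms affine smooth_functions_const[of 0] unfolding affine_connection_def by blast+

lemma
  assumes "X \<in> vector_fields A" "Y \<in> vector_fields A"
  shows D_closed: "D X Y \<in> vector_fields A"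
    and D_scale_right: "f \<in> smooth_functions A \<Longrightarrow> D X (f *\<^sub>V Y) = f *\<^sub>V D X Y + act X f *\<^sub>V Y"
  using assms affine smooth_functions_const[of 0] unfolding affine_connection_def by blast+

lemma D_diff_right:
  assumes "X \<in> vector_fields A" "Y \<in> vector_fields A" "Z \<in> vector_fields A"
  shows "D X (Y - Z) = D X Y - D X Z"
proof -
  have "D X ((Y - Z) + Z) = D X (Y - Z) + D X Z"
    by (rule D_add_right) (simp_all add: assms vector_fields_diff)
  then show ?thesis by (simp add: algebra_simps)
qed

lemma D_uminus_left:
  assumes "X \<in> vector_fields A" "Y \<in> vector_fields A"
  shows "D (- X) Y = - D X Y"
proof -
  have add: "D (U + V) Y = D U Y + D V Y" if "U \<in> vector_fields A" "V \<in> vector_fields A" for U V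
    using D_add_left[OF that assms(2)] .
  have "0 \<in> vector_fields A" using vector_fields_diff[OF assms(1,1)] by simp
  then have "D 0 Y = 0" using add[of 0 0] by simp
  then show ?thesis
    using add[OF assms(1) vector_fields_uminus[OF assms(1)]] by (simp add: eq_neg_iff_add_eq_0 add.commute)
qed

section \<open>Symmetries of the Levi-Civita curvature\<close>

lemma torsion_free: "X \<in> vector_fields A \<Longrightarrow> Y \<in> vector_fields A \<Longrightarrow> D X Y - D Y X = lie_bracket X Y"
  using levi_civita unfolding levi_civita_def by blast

sublocale LC: metric_connection A g D
proof
  \<comment> \<open>Torsion-freeness writes the bracket as a difference of covariant derivatives,
    which are fields already.\<close>
  show "lie_bracket X Y \<in> vector_fields A" if "X \<in> vector_fields A" "Y \<in> vector_fields A" for X Y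
    using that vector_fields_diff[OF D_closed[of X Y] D_closed[of Y X]] torsion_free by simp
  show "act X (ev2 g Y Z) = ev2 g (D X Y) Z + ev2 g Y (D X Z)"
    if "X \<in> vector_fields A" "Y \<in> vector_fields A" "Z \<in> vector_fields A" for X Y Z
    using that levi_civita unfolding levi_civita_def by blast
qed (rule D_closed)

text \<open>Regrouping the cyclic sum by its outermost field and using torsion-freeness twice turns
  each group into a double bracket, leaving the Jacobi identity.\<close>

lemma bianchi:
  assumes X: "X \<in> vector_fields A" and Y: "Y \<in> vector_fields A" and Z: "Z \<in> vector_fields A"
  shows "curvature D X Y Z + curvature D Y Z X + curvature D Z X Y = 0"
proof -
  note tf = torsion_free[symmetric]
  have swap: "D U (D V W) - D U (D W V) - D (lie_bracket V W) U = lie_bracket U (lie_bracket V W)"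
    if "U \<in> vector_fields A" "V \<in> vector_fields A" "W \<in> vector_fields A" for U V W
  proof -
    have "D U (lie_bracket V W) = D U (D V W) - D U (D W V)"
      by (simp add: tf that D_diff_right D_closed)
    then show ?thesis using torsion_free[of U "lie_bracket V W"] that LC.lie_bracket_closed by simp
  qed
  show ?thesis
    using lie_bracket_jacobi[OF X Y Z] swap[OF X Y Z] swap[OF Y Z X] swap[OF Z X Y]
    unfolding curvature_def by (simp add: algebra_simps)
qed

lemma pair_symmetry:
  assumes X: "X \<in> vector_fields A" and Y: "Y \<in> vector_fields A"
    and Z: "Z \<in> vector_fields A" and W: "W \<in> vector_fields A"
  shows "ev2 g (curvature D X Y Z) W = ev2 g (curvature D Z W X) Y"
proof
  fix p
  define r where "r X Y Z W = ev2 g (curvature D X Y Z) W p" for X Y Z W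
  have skew2: "r X Y Z W = - r X Y W Z"
    if "X \<in> vector_fields A" "Y \<in> vector_fields A" "Z \<in> vector_fields A" "W \<in> vector_fields A"
    for X Y Z W
    using LC.curvature_skew[OF that] by (simp add: r_def)
  have b: "r X Y Z W + r Y Z X W + r Z X Y W = 0"
    if X: "X \<in> vector_fields A" and Y: "Y \<in> vector_fields A"
    and Z: "Z \<in> vector_fields A" and W: "W \<in> vector_fields A" for X Y Z W
  proof -
    have "ev2 g (curvature D X Y Z + curvature D Y Z X + curvature D Z X Y) W p = 0"
      using bianchi[OF X Y Z] ev2_zero_left[OF W] by simp
    then show ?thesis
      by (simp add: ev2_add_left LC.curvature_closed vector_fields_add X Y Z W r_def)
  qed
  have skew1: "r X Y Z W = - r Y X Z W"
    if "X \<in> vector_fields A" "Y \<in> vector_fields A" "Z \<in> vector_fields A" "W \<in> vector_fields A"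
    for X Y Z W
  proof -
    have "lie_bracket X Y = - lie_bracket Y X" by (simp add: lie_bracket_def fun2_eq_iff)
    then have "D (lie_bracket X Y) Z = - D (lie_bracket Y X) Z"
      using that by (simp add: D_uminus_left LC.lie_bracket_closed)
    then have "curvature D X Y Z + curvature D Y X Z = 0"
      by (simp add: curvature_def)
    then have "ev2 g (curvature D X Y Z + curvature D Y X Z) W p = 0"
      using ev2_zero_left that by simp
    then show ?thesis
      using that by (simp add: ev2_add_left LC.curvature_closed r_def)
  qed
  show "ev2 g (curvature D X Y Z) W p = ev2 g (curvature D Z W X) Y p"
    \<comment> \<open>The first two of the four Bianchi sums minus the last two: by skewness in both
      pairs the mixed terms cancel, and twice the claimed difference remains.\<close>
    unfolding r_def[symmetric]
    using b[OF X Y Z W] b[OF Y Z W X] b[OF Z W X Y] b[OF W X Y Z]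
      skew1[OF X Z W Y] skew1[OF Y W X Z] skew2[OF Y Z W X] skew2[OF Z W Y X] skew2[OF Z X W Y]
      skew2[OF W X Y Z] skew2[OF X Y W Z] skew2[OF W Y X Z]
    by linarith
qed

section \<open>Structure tensors on fields and curvature in the direction xi\<close>

abbreviation (input) F where "F X \<equiv> ev1 \<phi> X"
abbreviation (input) G where "G X Y \<equiv> ev2 g X Y"
abbreviation (input) H where "H X \<equiv> ev1 \<eta> X"

lemma
  assumes "X \<in> vector_fields A"
  shows F_closed: "F X \<in> vector_fields A" and H_smooth: "H X \<in> smooth_functions A"
  using assms endomorphism_field one_form unfolding endomorphism_field_def one_form_def by blast+

lemma \<phi>_linear:
  assumes "u \<in> tangent_space A p" "v \<in> tangent_space A p"
  shows "\<phi> p u \<in> tangent_space A p" "\<phi> p (u + v) = \<phi> p u + \<phi> p v"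
  using assms endomorphism_field unfolding endomorphism_field_def by blast+

lemma \<eta>_linear:
  assumes "u \<in> tangent_space A p" "v \<in> tangent_space A p"
  shows "\<eta> p (u + v) = \<eta> p u + \<eta> p v" "\<eta> p (a *\<^sub>T u) = a * \<eta> p u"
  using assms one_form unfolding one_form_def by blast+

lemma F_diff:
  assumes "X \<in> vector_fields A" "Y \<in> vector_fields A"
  shows "F (X - Y) = F X - F Y"
proof
  fix p
  have "\<phi> p (X p - Y p + Y p) = \<phi> p (X p - Y p) + \<phi> p (Y p)"
    by (rule \<phi>_linear) (simp_all add: assms vector_fieldsD tangent_space_diff)
  then show "F (X - Y) p = (F X - F Y) p" by (simp add: ev1_def algebra_simps)
qed

lemma
  assumes "X \<in> vector_fields A"
  shows H_F: "H (F X) = 0"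
    and G_\<xi>: "G X \<xi> = H X"
    and G_F_F: "Y \<in> vector_fields A \<Longrightarrow> G (F X) (F Y) = G X Y - H X * H Y"
    and D_\<xi>: "D X \<xi> = F X"
  using assms para_sasakian unfolding para_sasakian_def by blast+

lemma D_F:
  assumes "X \<in> vector_fields A" "Y \<in> vector_fields A"
  shows "D X (F Y) = F (D X Y) - G X Y *\<^sub>V \<xi> - H Y *\<^sub>V X + (2 * H X * H Y) *\<^sub>V \<xi>"
proof -
  have "D X (F Y) - F (D X Y) = - (G X Y *\<^sub>V \<xi>) - H Y *\<^sub>V X + (2 * H X * H Y) *\<^sub>V \<xi>"
    using assms para_sasakian unfolding para_sasakian_def by blast
  then show ?thesis by (simp add: algebra_simps)
qed

lemma two_smooth: "2 \<in> smooth_functions A"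
  using smooth_functions_add[OF smooth_functions_const[of 1] smooth_functions_const[of 1]]
  by (simp flip: one_fun_def)

lemmas field_closure = two_smooth \<xi>_field D_closed F_closed H_smooth ev2_smooth smooth_functions_add smooth_functions_mult
  vector_fields_add vector_fields_diff vector_fields_scale LC.lie_bracket_closed

text \<open>Since D_X xi = phi X, the curvature on xi is (D_X phi) Y - (D_Y phi) X, and the terms
  along xi are symmetric in X and Y.\<close>

lemma curvature_\<xi>:
  assumes X: "X \<in> vector_fields A" and Y: "Y \<in> vector_fields A"
  shows "curvature D X Y \<xi> = H X *\<^sub>V Y - H Y *\<^sub>V X"
proof -
  have "F (lie_bracket X Y) = F (D X Y) - F (D Y X)"
    by (simp add: X Y field_closure F_diff flip: torsion_free)
  then have "curvature D X Y \<xi> = D X (F Y) - D Y (F X) - (F (D X Y) - F (D Y X))"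
    by (simp add: curvature_def D_\<xi> X Y field_closure)
  also have "\<dots> = H X *\<^sub>V Y - H Y *\<^sub>V X"
    using ev2_sym[OF X Y] by (simp add: D_F X Y fun2_eq_iff scale_vfield_def scale_tvec_def algebra_simps)
  finally show ?thesis .
qed

text \<open>Pair symmetry makes the curvature tensorial in its first argument as well, so it suffices
  that \<open>X\<close> agrees with \<open>\<xi>\<close> at the point.\<close>

lemma curvature_\<xi>_first:
  assumes X: "X \<in> vector_fields A" and Y: "Y \<in> vector_fields A" and Z: "Z \<in> vector_fields A"
    and p: "X p = \<xi> p"
  shows "curvature D X Y Z p = \<eta> p (Z p) *\<^sub>T Y p - g p (Y p) (Z p) *\<^sub>T \<xi> p"
proof (rule g_nondegenerate)
  show "curvature D X Y Z p \<in> tangent_space A p"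
    by (simp add: LC.curvature_closed X Y Z vector_fieldsD)
  show "\<eta> p (Z p) *\<^sub>T Y p - g p (Y p) (Z p) *\<^sub>T \<xi> p \<in> tangent_space A p"
    by (simp add: X Y Z \<xi>_field vector_fieldsD tangent_space_diff tangent_space_scale)
  fix W assume W: "W \<in> vector_fields A"
  have "g p (curvature D X Y Z p) (W p) = g p (curvature D Z W X p) (Y p)"
    using fun_cong[OF pair_symmetry[OF X Y Z W], of p] by (simp add: ev2_def)
  also have "curvature D Z W X p = curvature D Z W \<xi> p"
    by (rule LC.curvature_tensorial[OF Z W X \<xi>_field p])
  also have "g p (curvature D Z W \<xi> p) (Y p) = G (H Z *\<^sub>V W - H W *\<^sub>V Z) Y p"
    by (simp add: curvature_\<xi>[OF Z W] ev2_def)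
  also have "\<dots> = G (H Z *\<^sub>V Y - G Y Z *\<^sub>V \<xi>) W p"
    using G_\<xi>[OF W] ev2_sym[OF W Y] ev2_sym[OF W \<xi>_field] ev2_sym[OF Z Y]
    by (simp add: ev2_diff_left ev2_scale_left field_closure W Y Z)
  finally show "g p (curvature D X Y Z p) (W p) =
      g p (\<eta> p (Z p) *\<^sub>T Y p - g p (Y p) (Z p) *\<^sub>T \<xi> p) (W p)"
    by (simp add: ev2_def ev1_def scale_vfield_def)
qed

section \<open>The quarter-symmetric connection and its curvature\<close>

abbreviation Dt :: "'a connection" where
  "Dt \<equiv> quarter_symmetric_connection \<phi> \<xi> \<eta> g D"

lemma Dt: "Dt X Y = D X Y + H Y *\<^sub>V F X - G (F X) Y *\<^sub>V \<xi>"
  by (rule quarter_symmetric_connection_def)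

lemma Dt_closed: "X \<in> vector_fields A \<Longrightarrow> Y \<in> vector_fields A \<Longrightarrow> Dt X Y \<in> vector_fields A"
  by (simp add: Dt field_closure)

lemma G_\<xi>_left: "X \<in> vector_fields A \<Longrightarrow> G \<xi> X = H X"
  using G_\<xi> ev2_sym \<xi>_field by metis

text \<open>The correction pairs with Z to eta(Y) g(phi X,Z) - g(phi X,Y) eta(Z), which is skew in Y
  and Z and so cancels from the compatibility condition.\<close>

sublocale QS: metric_connection A g Dt
proof
  fix X Y Z
  assume X: "X \<in> vector_fields A" and Y: "Y \<in> vector_fields A" and Z: "Z \<in> vector_fields A"
  show "act X (ev2 g Y Z) = ev2 g (Dt X Y) Z + ev2 g Y (Dt X Z)"
    unfolding LC.compatible[OF X Y Z] Dt using ev2_sym[OF Y F_closed[OF X]]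
    by (simp add: ev2_add_left ev2_add_right ev2_diff_left ev2_diff_right ev2_scale_left
        ev2_scale_right G_\<xi> G_\<xi>_left X Y Z field_closure)
qed (auto intro: Dt_closed LC.lie_bracket_closed)

text \<open>Terms are grouped by origin: the product rule for eta(Z) phi Y, the product rule for
  g(phi Y,Z) xi, then the two corrections of the outer connection. Cancellation waits until X and Y
  are exchanged.\<close>

lemma Dt_Dt:
  assumes X: "X \<in> vector_fields A" and Y: "Y \<in> vector_fields A" and Z: "Z \<in> vector_fields A"
  shows "Dt X (Dt Y Z) = D X (D Y Z)
      + (H Z *\<^sub>V (F (D X Y) - G X Y *\<^sub>V \<xi> - H Y *\<^sub>V X + (2 * H X * H Y) *\<^sub>V \<xi>)
         + (H (D X Z) + G (F X) Z) *\<^sub>V F Y)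
      - (G (F Y) Z *\<^sub>V F X
         + (G (F (D X Y)) Z - G X Y * H Z - H Y * G X Z + 2 * H X * H Y * H Z + G (F Y) (D X Z)) *\<^sub>V \<xi>)
      + (H (D Y Z) - G (F Y) Z) *\<^sub>V F X
      - (G (F X) (D Y Z) + H Z * (G X Y - H X * H Y)) *\<^sub>V \<xi>"
proof -
  have H_Dt: "H (Dt Y Z) = H (D Y Z) - G (F Y) Z"
  proof -
    have "H (Dt Y Z) = G (Dt Y Z) \<xi>" by (simp add: G_\<xi> Dt_closed Y Z)
    also have "\<dots> = H (D Y Z) - G (F Y) Z"
      by (simp only: Dt ev2_add_left ev2_diff_left ev2_scale_left X Y Z field_closure)
         (simp add: G_\<xi> H_F \<eta>_\<xi> Y Z field_closure)
    finally show ?thesis .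
  qed
  have G_Dt: "G (F X) (Dt Y Z) = G (F X) (D Y Z) + H Z * (G X Y - H X * H Y)"
    by (simp add: Dt ev2_add_right ev2_diff_right ev2_scale_right G_F_F G_\<xi> H_F X Y Z field_closure)
  \<comment> \<open>Differentiating eta(Z) = g(Z,xi) also hits xi, and D_X xi = phi X produces the
    extra term.\<close>
  have act_H: "act X (H Z) = H (D X Z) + G (F X) Z"
    using LC.compatible[OF X Z \<xi>_field] ev2_sym[OF Z F_closed[OF X]]
    by (simp add: G_\<xi> D_\<xi> X Z field_closure)
  have act_G: "act X (G (F Y) Z) =
      G (F (D X Y)) Z - G X Y * H Z - H Y * G X Z + 2 * H X * H Y * H Z + G (F Y) (D X Z)"
    by (simp add: LC.compatible D_F ev2_add_left ev2_diff_left ev2_scale_left G_\<xi>_left X Y Z field_closure)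
  have "D X (Dt Y Z) = D X (D Y Z) + D X (H Z *\<^sub>V F Y) - D X (G (F Y) Z *\<^sub>V \<xi>)"
    by (simp add: Dt D_diff_right D_add_right X Y Z field_closure)
  also have "\<dots> = D X (D Y Z) + (H Z *\<^sub>V D X (F Y) + act X (H Z) *\<^sub>V F Y)
      - (G (F Y) Z *\<^sub>V F X + act X (G (F Y) Z) *\<^sub>V \<xi>)"
    by (simp add: D_scale_right D_\<xi> X Y Z field_closure)
  finally show ?thesis
    unfolding Dt[of X "Dt Y Z"] H_Dt G_Dt act_H act_G D_F[OF X Y] by simp
qed

text \<open>The 3 counts the sources of g(phi X,Z) phi Y: the derivative of eta(Z), the derivative
  D_Y xi = phi Y, and eta applied to the xi part of the inner connection. The terms free of phi are
  what exchanging X and Y leaves of the derivatives of phi.\<close>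

lemma curvature_Dt:
  assumes X: "X \<in> vector_fields A" and Y: "Y \<in> vector_fields A" and Z: "Z \<in> vector_fields A"
  shows "curvature Dt X Y Z = curvature D X Y Z
     + (3 * G (F X) Z) *\<^sub>V F Y - (3 * G (F Y) Z) *\<^sub>V F X
     + H Z *\<^sub>V (H X *\<^sub>V Y - H Y *\<^sub>V X) - (H X * G Y Z - H Y * G X Z) *\<^sub>V \<xi>"
proof -
  have F: "F (lie_bracket X Y) = F (D X Y) - F (D Y X)"
    by (simp add: X Y field_closure F_diff flip: torsion_free)
  have "G (F (lie_bracket X Y)) Z = G (F (D X Y)) Z - G (F (D Y X)) Z"
    by (simp add: F ev2_diff_left X Y Z field_closure)
  then have lie: "Dt (lie_bracket X Y) Z = D (lie_bracket X Y) Z + H Z *\<^sub>V (F (D X Y) - F (D Y X))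
     - (G (F (D X Y)) Z - G (F (D Y X)) Z) *\<^sub>V \<xi>"
    by (simp add: Dt F)
  have "G Y X = G X Y" using ev2_sym[OF Y X] .
  then show ?thesis
    unfolding curvature_def lie Dt_Dt[OF X Y Z] Dt_Dt[OF Y X Z]
    by (simp add: fun2_eq_iff scale_vfield_def scale_tvec_def) (simp add: algebra_simps)
qed

text \<open>The phi terms contain g(phi X,xi) = eta(phi X) = 0 and the xi term cancels. The
  Levi-Civita part and the term with eta(xi) = 1 are equal, hence the 2.\<close>

lemma curvature_Dt_\<xi>:
  assumes X: "X \<in> vector_fields A" and Y: "Y \<in> vector_fields A"
  shows "curvature Dt X Y \<xi> = 2 *\<^sub>V (H X *\<^sub>V Y - H Y *\<^sub>V X)"
  unfolding curvature_Dt[OF X Y \<xi>_field] curvature_\<xi>[OF X Y]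
  by (simp add: G_\<xi> H_F \<eta>_\<xi> X Y field_closure)
     (simp add: fun2_eq_iff scale_vfield_def scale_tvec_def algebra_simps)

text \<open>The extension chosen for \<open>\<xi> p\<close> may differ from xi away from p;
  tensoriality in the third slot replaces it by xi itself.\<close>

lemma curvature_at_Dt_\<xi>:
  assumes u: "u \<in> tangent_space A p" and v: "v \<in> tangent_space A p"
  shows "curvature_at A Dt p u v (\<xi> p) = 2 *\<^sub>T (\<eta> p u *\<^sub>T v - \<eta> p v *\<^sub>T u)"
proof -
  note uv = extend_tvec_in[OF u] extend_tvec_in[OF v]
  have \<xi>: "\<xi> p \<in> tangent_space A p" using \<xi>_field by (rule vector_fieldsD)
  have "curvature_at A Dt p u v (\<xi> p) = curvature Dt (extend_tvec A p u) (extend_tvec A p v) \<xi> p"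
    unfolding curvature_at_def
    by (rule QS.curvature_tensorial) (simp_all add: uv \<xi> \<xi>_field extend_tvec_in)
  then show ?thesis
    by (simp add: curvature_Dt_\<xi>[OF uv] scale_vfield_def ev1_def u v)
qed

text \<open>The corrections in \<open>curvature_Dt\<close> depend on X only at p, and
  \<open>curvature_\<xi>_first\<close> treats the Levi-Civita part. With phi xi = 0 and eta(xi) = 1,
  each of the two contributes one negative wedge.\<close>

lemma curvature_at_Dt_\<xi>_first:
  assumes v: "v \<in> tangent_space A p" and w: "w \<in> tangent_space A p"
  shows "curvature_at A Dt p (\<xi> p) v w = (-2) *\<^sub>T wedge (g p) (\<xi> p) v w"
proof -
  have \<xi>: "\<xi> p \<in> tangent_space A p" using \<xi>_field by (rule vector_fieldsD)
  define X Y Z where "X = extend_tvec A p (\<xi> p)" "Y = extend_tvec A p v" "Z = extend_tvec A p w"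
  then have vf: "X \<in> vector_fields A" "Y \<in> vector_fields A" "Z \<in> vector_fields A"
    and at: "X p = \<xi> p" "Y p = v" "Z p = w"
    using v w \<xi> by (simp_all add: extend_tvec_in)
  have \<phi>0: "\<phi> p (\<xi> p) = 0" and \<eta>1: "\<eta> p (\<xi> p) = 1"
    using fun_cong[OF \<phi>_\<xi>, of p] fun_cong[OF \<eta>_\<xi>, of p] by (simp_all add: ev1_def)
  have g\<xi>: "g p (\<xi> p) w = \<eta> p w"
    using fun_cong[OF G_\<xi>_left[OF vf(3)], of p] by (simp add: ev1_def ev2_def at)
  have g0: "g p 0 w = 0" using g_diff_left[OF w w w] by simp
  have "curvature_at A Dt p (\<xi> p) v w = curvature Dt X Y Z p"
    by (simp add: curvature_at_def X_Y_Z_def)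
  also have "\<dots> = (-2) *\<^sub>T wedge (g p) (\<xi> p) v w"
    by (simp add: curvature_Dt[OF vf] curvature_\<xi>_first[OF vf at(1)] ev1_def ev2_def scale_vfield_def
        at \<phi>0 \<eta>1 g\<xi> g0 wedge_def)
       (simp add: fun_eq_iff scale_tvec_def algebra_simps)
  finally show ?thesis .
qed

section \<open>Projective curvature on xi and the pseudosymmetry condition\<close>

lemma projective_curvature_at_Dt_\<xi>:
  assumes u: "u \<in> tangent_space A p" and v: "v \<in> tangent_space A p" and n: "CARD('n) > 1"
  shows "projective_curvature_at A Dt p u v (\<xi> p) = 0"
proof -
  have ricci: "ricci_at A Dt p v (\<xi> p) = 2 * (1 - real CARD('n)) * \<eta> p v"
    if "v \<in> tangent_space A p" for v
    unfolding ricci_at_def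
    by (rule tangent_trace_wedge[OF conjI[OF \<eta>_linear] that curvature_at_Dt_\<xi>[OF _ that]])
  define m where "m = real CARD('n) - 1"
  have m: "m \<noteq> 0" using n by (simp add: m_def)
  \<comment> \<open>Factored so that m cancels against the 1/(n-1) in the projective
    curvature.\<close>
  have ricci: "ricci_at A Dt p v (\<xi> p) = m * (-2 * \<eta> p v)" if "v \<in> tangent_space A p" for v
    unfolding ricci[OF that] by (simp add: m_def algebra_simps)
  have "(1 / m) *\<^sub>T (ricci_at A Dt p v (\<xi> p) *\<^sub>T u - ricci_at A Dt p u (\<xi> p) *\<^sub>T v)
     = (-2) *\<^sub>T (\<eta> p v *\<^sub>T u - \<eta> p u *\<^sub>T v)"
    unfolding ricci[OF u] ricci[OF v] using m
    by (simp add: scale_tvec_def fun_eq_iff diff_divide_distrib add_divide_distrib)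
  then show ?thesis
    unfolding projective_curvature_at_def curvature_at_Dt_\<xi>[OF u v] m_def[symmetric]
    by (simp add: scale_tvec_def fun_eq_iff algebra_simps)
qed

text \<open>The vector w on which flatness is tested is also used as second argument of the
  curvature and of the wedge. Sending xi to eta(w) xi - w, the wedge carries w into the third slot
  of the projective curvature, where the part along xi is annihilated.\<close>

lemma pseudosymmetric_imp_flat:
  assumes n: "CARD('n) > 1"
    and pseudo: "\<And>v u1 u2 u3. v \<in> tangent_space A p \<Longrightarrow> u1 \<in> tangent_space A p \<Longrightarrow>
      u2 \<in> tangent_space A p \<Longrightarrow> u3 \<in> tangent_space A p \<Longrightarrow>
      derivation_action (curvature_at A Dt p (\<xi> p) v) (projective_curvature_at A Dt p) u1 u2 u3
       = l *\<^sub>T derivation_action (wedge (g p) (\<xi> p) v) (projective_curvature_at A Dt p) u1 u2 u3"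
    and l: "l \<noteq> - 2"
  shows "projectively_flat_at A Dt p"
  unfolding projectively_flat_at_def
proof (intro ballI)
  fix u v w
  assume u: "u \<in> tangent_space A p" and v: "v \<in> tangent_space A p" and w: "w \<in> tangent_space A p"
  let ?P = "projective_curvature_at A Dt p" and ?B = "wedge (g p) (\<xi> p) w"
  have \<xi>: "\<xi> p \<in> tangent_space A p" using \<xi>_field by (rule vector_fieldsD)
  have P_lin: "?P u v (a *\<^sub>T x + y) = a *\<^sub>T ?P u v x + ?P u v y"
    if "x \<in> tangent_space A p" "y \<in> tangent_space A p" for a x y
    by (rule QS.projective_curvature_at_linear[OF u v that])
  note P\<xi> = projective_curvature_at_Dt_\<xi>[OF _ _ n]
  have scale0: "a *\<^sub>T 0 = 0" for a by (simp add: scale_tvec_def fun_eq_iff)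
  have zero: "0 \<in> tangent_space A p" using tangent_space_diff[OF u u] by simp
  have B_in: "?B x \<in> tangent_space A p" for x
    by (simp add: wedge_def tangent_space_diff tangent_space_scale \<xi> w)
  have R: "curvature_at A Dt p (\<xi> p) w x = (-2) *\<^sub>T ?B x" if "x \<in> tangent_space A p" for x
    by (rule curvature_at_Dt_\<xi>_first[OF w that])
  have g0: "g p x 0 = 0" if x: "x \<in> tangent_space A p" for x
    using g_diff_left[OF x x x] g_sym[OF zero x] by simp
  have B0: "?B 0 = 0" by (simp add: wedge_def g0 w \<xi> scale_tvec_def fun_eq_iff)
  have "g p w (\<xi> p) = \<eta> p w"
    using fun_cong[OF G_\<xi>[OF extend_tvec_in[OF w]], of p] w by (simp add: ev1_def ev2_def)
  moreover have "g p (\<xi> p) (\<xi> p) = 1"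
    using fun_cong[OF G_\<xi>[OF \<xi>_field], of p] fun_cong[OF \<eta>_\<xi>, of p]
    by (simp add: ev1_def ev2_def)
  ultimately have B\<xi>: "?B (\<xi> p) = \<eta> p w *\<^sub>T \<xi> p + (-1) *\<^sub>T w"
    by (simp add: wedge_def scale_tvec_def fun_eq_iff)
  have P0: "?P u v 0 = 0"
  proof -
    have "?P u v (1 *\<^sub>T 0 + 0) = 1 *\<^sub>T ?P u v 0 + ?P u v 0" by (rule P_lin[OF zero zero])
    then have "?P u v 0 = ?P u v 0 + ?P u v 0" by (simp only: scale0 add_0) (simp add: scale_tvec_def)
    then show ?thesis by simp
  qed
  have "?P u v ((-1) *\<^sub>T w + \<eta> p w *\<^sub>T \<xi> p) = (-1) *\<^sub>T ?P u v w + ?P u v (\<eta> p w *\<^sub>T \<xi> p)"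
    by (rule P_lin) (simp_all add: w \<xi> tangent_space_scale)
  moreover have "?P u v (\<eta> p w *\<^sub>T \<xi> p) = 0"
    using P_lin[OF \<xi> zero, of "\<eta> p w"] by (simp only: P0 P\<xi>[OF u v] scale0 add_0_right)
  ultimately have PB: "?P u v (?B (\<xi> p)) = (-1) *\<^sub>T ?P u v w"
    by (simp add: B\<xi> add.commute)
  have "?P u v ((-2) *\<^sub>T ?B (\<xi> p) + 0) = (-2) *\<^sub>T ?P u v (?B (\<xi> p)) + ?P u v 0"
    by (rule P_lin[OF B_in zero])
  then have PR: "?P u v ((-2) *\<^sub>T ?B (\<xi> p)) = 2 *\<^sub>T ?P u v w"
    by (simp only: PB P0 add_0_right) (simp add: scale_tvec_def fun_eq_iff)
  \<comment> \<open>Only the last term of the derivation survives, with signs -P(u,v)(-2 B xi) = 2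
    P(u,v)(B xi) = -2 P(u,v) w.\<close>
  have "derivation_action (curvature_at A Dt p (\<xi> p) w) ?P u v (\<xi> p) = - (2 *\<^sub>T ?P u v w)"
    by (simp only: derivation_action_def P\<xi> u v R zero \<xi> B0 scale0 tangent_space_scale B_in PR) simp
  moreover have "derivation_action ?B ?P u v (\<xi> p) = ?P u v w"
    by (simp only: derivation_action_def P\<xi> u v B0 B_in PB) (simp add: scale_tvec_def fun_eq_iff)
  ultimately have "- (2 *\<^sub>T ?P u v w) = l *\<^sub>T ?P u v w"
    using pseudo[OF w u v \<xi>] by simp
  then have "- (2 * ?P u v w f) = l * ?P u v w f" for f
    by (auto simp: scale_tvec_def dest: fun_cong[where x = f])
  then have "(l + 2) * ?P u v w f = 0" for f
    by (simp add: distrib_right eq_neg_iff_add_eq_0[symmetric])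
  then show "?P u v w = 0" using l by (auto simp: fun_eq_iff)
qed

end

theorem theorem4:
  fixes A :: "('a::{t2_space,second_countable_topology}, 'n::finite) chart set"
    and \<phi> :: "'a \<Rightarrow> 'a tvec \<Rightarrow> 'a tvec"
    and \<xi> :: "'a vfield"
    and \<eta> :: "'a \<Rightarrow> 'a tvec \<Rightarrow> real"
    and g :: "'a \<Rightarrow> 'a tvec \<Rightarrow> 'a tvec \<Rightarrow> real"
    and D Dt :: "'a connection"
    and L :: "'a \<Rightarrow> real"
  assumes "CARD('n) > 1"
    and "para_sasakian A \<phi> \<xi> \<eta> g D"
    and "Dt = quarter_symmetric_connection \<phi> \<xi> \<eta> g D"
    and "projectively_pseudosymmetric A g Dt L"
  shows "(\<forall>p. projectively_flat_at A Dt p) \<or>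
         (\<forall>p. \<not> projectively_flat_at A Dt p \<longrightarrow> L p = -2)"
proof (rule disjI2, intro allI impI, rule ccontr)
  \<comment> \<open>The argument works at one point at a time. If every point is flat, the second
    alternative holds vacuously, so proving that one covers both.\<close>
  fix p
  assume nonflat: "\<not> projectively_flat_at A Dt p" and "L p \<noteq> -2"
  interpret para_sasakian_manifold A \<phi> \<xi> \<eta> g D by unfold_locales fact
  have "projectively_flat_at A Dt p"
    unfolding assms(3)
  proof (rule pseudosymmetric_imp_flat[OF assms(1) _ \<open>L p \<noteq> -2\<close>])
    fix v u1 u2 u3
    assume v: "v \<in> tangent_space A p" and u: "u1 \<in> tangent_space A p"
      "u2 \<in> tangent_space A p" "u3 \<in> tangent_space A p"
    show "derivation_action (curvature_at A (quarter_symmetric_connection \<phi> \<xi> \<eta> g D) p (\<xi> p) v)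
        (projective_curvature_at A (quarter_symmetric_connection \<phi> \<xi> \<eta> g D) p) u1 u2 u3
       = L p *\<^sub>T derivation_action (wedge (g p) (\<xi> p) v)
        (projective_curvature_at A (quarter_symmetric_connection \<phi> \<xi> \<eta> g D) p) u1 u2 u3"
      \<comment> \<open>The condition quantifies over fields: X is taken to be xi and Y the chosen
        extension of v, whose value at p is v.\<close>
      using assms(4)[unfolded projectively_pseudosymmetric_def, rule_format,
          OF nonflat \<xi>_field extend_tvec_in[OF v] u] extend_tvec_at[OF v]
      by (simp add: assms(3))
  qed
  with nonflat show False by simp
qed

end
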